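(* There exists a Banach space $X$ which is not reflexive, but such that the family $([\mathbb{N}]^k,d^{(k)}_{\mathbb{H}})_{k\in\mathbb{N}}$ does not equi-coarsely embed into $X$.
   Context: $[\mathbb{N}]^k$ is the set of $k$-element subsets of $\mathbb{N}$, whose elements $\bar m=\{m_1,\dots,m_k\}$ are listed in increasing order. The Hamming distance on $[\mathbb{N}]^k$ is $d^{(k)}_{\mathbb{H}}(\bar m,\bar n)=|\{i\in\{1,\dots,k\}:m_i\ne n_i\}|$. For a map $f:(X,d_X)\to(Y,d_Y)$ between metric spaces let $\rho_f(t)=\inf\{d_Y(f(x),f(y)):d_X(x,y)\ge t\}$ and $\omega_f(t)=\sup\{d_Y(f(x),f(y)):d_X(x,y)\le t\}$, with the conventions $\inf\emptyset=+\infty$, $\sup\emptyset=0$. A family of metric spaces $(X_i)_{i\in I}$ equi-coarsely embeds into a metric space $Y$ if there exist non-decreasing functions $\rho,\omega:[0,\infty)\to[0,\infty)$ and, for all $i\in I$, maps $f_i:X_i\to Y$ such that $\rho\le\rho_{f_i}$, $\omega_{f_i}\le\omega$, $\lim_{t\to\infty}\rho(t)=\infty$ and $\omega(t)<\infty$ for all $t>0$. *)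

theory Defs
  imports "HOL-Analysis.Analysis" "HOL-Library.Function_Algebras"
begin

section \<open>Real Banach spaces on carriers\<close>

text \<open>
  HOL cannot quantify existentially over types.  A Banach space is therefore given by a
  linear subspace \<open>V\<close> of some ambient real vector space and a norm \<open>N\<close> on \<open>V\<close>, which is
  unrelated to any norm or topology of the ambient space.  The ambient space only supplies the
  linear operations: in \<open>nat \<Rightarrow> real\<close>, for instance, every real vector space of dimension at
  most the continuum, in particular every separable Banach space, can be found up to linear
  isomorphism.
\<close>

instantiation "fun" :: (type, real_vector) real_vector
begin

definition scaleR_fun_def: "c *\<^sub>R f = (\<lambda>x. c *\<^sub>R f x)"

instance
  by standard (simp_all add: scaleR_fun_def fun_eq_iff scaleR_add_right scaleR_add_left)

end

lemma scaleR_fun_apply [simp]: "(c *\<^sub>R f) x = c *\<^sub>R f x"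
  by (simp add: scaleR_fun_def)

definition norm_on :: "'a::real_vector set \<Rightarrow> ('a \<Rightarrow> real) \<Rightarrow> bool" where
  "norm_on V N \<longleftrightarrow>
     (\<forall>x\<in>V. 0 \<le> N x) \<and> (\<forall>x\<in>V. N x = 0 \<longleftrightarrow> x = 0) \<and>
     (\<forall>c. \<forall>x\<in>V. N (c *\<^sub>R x) = \<bar>c\<bar> * N x) \<and>
     (\<forall>x\<in>V. \<forall>y\<in>V. N (x + y) \<le> N x + N y)"

text \<open>
  The metric type requires a distance that is symmetric and nonnegative on the whole type, hence
  the value 0 off the carrier.
\<close>

definition norm_metric :: "'a::real_vector set \<Rightarrow> ('a \<Rightarrow> real) \<Rightarrow> 'a metric" where
  "norm_metric V N = metric (V, \<lambda>x y. if x \<in> V \<and> y \<in> V then N (x - y) else 0)"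

definition banach_on :: "'a::real_vector set \<Rightarrow> ('a \<Rightarrow> real) \<Rightarrow> bool" where
  "banach_on V N \<longleftrightarrow> subspace V \<and> norm_on V N \<and> mcomplete_of (norm_metric V N)"

lemma
  assumes "subspace V" "norm_on V N"
  shows mspace_norm_metric: "mspace (norm_metric V N) = V"
    and mdist_norm_metric: "\<And>x y. x \<in> V \<Longrightarrow> y \<in> V \<Longrightarrow> mdist (norm_metric V N) x y = N (x - y)"
proof -
  have diff: "x - y \<in> V" if "x \<in> V" "y \<in> V" for x y
    using assms(1) that by (rule subspace_diff)
  interpret Metric_space V "\<lambda>x y. if x \<in> V \<and> y \<in> V then N (x - y) else 0"
  proof
    show "0 \<le> (if x \<in> V \<and> y \<in> V then N (x - y) else 0)" for x y
      using assms(2) diff by (auto simp: norm_on_def)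
    show "(if x \<in> V \<and> y \<in> V then N (x - y) else 0) = (if y \<in> V \<and> x \<in> V then N (y - x) else 0)"
      for x y
    proof -
      have "N (y - x) = N (x - y)" if "x \<in> V" "y \<in> V"
      proof -
        have "N ((-1) *\<^sub>R (x - y)) = \<bar>-1\<bar> * N (x - y)"
          using assms(2) diff[OF that] unfolding norm_on_def by blast
        then show ?thesis by simp
      qed
      then show ?thesis by auto
    qed
    show "((if x \<in> V \<and> y \<in> V then N (x - y) else 0) = 0) = (x = y)" if "x \<in> V" "y \<in> V" for x y
      using assms(2) diff[OF that] that by (auto simp: norm_on_def)
    show "(if x \<in> V \<and> z \<in> V then N (x - z) else 0)
        \<le> (if x \<in> V \<and> y \<in> V then N (x - y) else 0) + (if y \<in> V \<and> z \<in> V then N (y - z) else 0)"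
      if "x \<in> V" "y \<in> V" "z \<in> V" for x y z
    proof -
      have "N ((x - y) + (y - z)) \<le> N (x - y) + N (y - z)"
        using assms(2) diff[OF that(1,2)] diff[OF that(2,3)] unfolding norm_on_def by blast
      moreover have "(x - y) + (y - z) = x - z"
        by simp
      ultimately show ?thesis using that by simp
    qed
  qed
  show "mspace (norm_metric V N) = V"
    by (simp add: norm_metric_def)
  show "mdist (norm_metric V N) x y = N (x - y)" if "x \<in> V" "y \<in> V" for x y
    using that by (simp add: norm_metric_def)
qed

text \<open>
  Functionals on \<open>V\<close> are extended by 0 to the whole type, so that distinct elements of the dual
  are distinct functions.  The dual is again a subspace of a real vector space, and the
  construction can be iterated.
\<close>

definition dual_space :: "'a::real_vector set \<Rightarrow> ('a \<Rightarrow> real) \<Rightarrow> ('a \<Rightarrow> real) set" where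
  "dual_space V N =
     {f. (\<forall>x\<in>V. \<forall>y\<in>V. f (x + y) = f x + f y) \<and>
         (\<forall>c. \<forall>x\<in>V. f (c *\<^sub>R x) = c * f x) \<and>
         (\<exists>B. \<forall>x\<in>V. \<bar>f x\<bar> \<le> B * N x) \<and>
         (\<forall>x. x \<notin> V \<longrightarrow> f x = 0)}"

definition dual_norm :: "'a::real_vector set \<Rightarrow> ('a \<Rightarrow> real) \<Rightarrow> ('a \<Rightarrow> real) \<Rightarrow> real" where
  "dual_norm V N f = (SUP x\<in>{x\<in>V. N x \<le> 1}. \<bar>f x\<bar>)"

definition canonical_embedding ::
    "'a::real_vector set \<Rightarrow> ('a \<Rightarrow> real) \<Rightarrow> 'a \<Rightarrow> ('a \<Rightarrow> real) \<Rightarrow> real" where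
  "canonical_embedding V N x = (\<lambda>f. if f \<in> dual_space V N then f x else 0)"

definition reflexive_on :: "'a::real_vector set \<Rightarrow> ('a \<Rightarrow> real) \<Rightarrow> bool" where
  "reflexive_on V N \<longleftrightarrow>
     canonical_embedding V N ` V = dual_space (dual_space V N) (dual_norm V N)"

lemma subspace_dual_space: "subspace (dual_space V N)"
proof (rule subspaceI)
  show "0 \<in> dual_space V N"
    by (auto simp: dual_space_def intro!: exI[of _ 0])
next
  fix f g assume "f \<in> dual_space V N" "g \<in> dual_space V N"
  moreover obtain B where "\<forall>x\<in>V. \<bar>f x\<bar> \<le> B * N x"
    using calculation(1) by (auto simp: dual_space_def)
  moreover obtain C where "\<forall>x\<in>V. \<bar>g x\<bar> \<le> C * N x"
    using calculation(2) by (auto simp: dual_space_def)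
  ultimately have "\<forall>x\<in>V. \<bar>f x + g x\<bar> \<le> (B + C) * N x"
    by (simp add: distrib_right) (meson abs_triangle_ineq add_mono order_trans)
  then have "\<exists>B. \<forall>x\<in>V. \<bar>f x + g x\<bar> \<le> B * N x"
    by blast
  then show "f + g \<in> dual_space V N"
    using \<open>f \<in> dual_space V N\<close> \<open>g \<in> dual_space V N\<close>
    by (simp add: dual_space_def distrib_left)
next
  fix c f assume f: "f \<in> dual_space V N"
  then obtain B where "\<forall>x\<in>V. \<bar>f x\<bar> \<le> B * N x"
    by (auto simp: dual_space_def)
  then have "\<forall>x\<in>V. \<bar>c * f x\<bar> \<le> (\<bar>c\<bar> * B) * N x"
    by (simp add: abs_mult mult.assoc mult_left_mono)
  with f have "\<exists>B. \<forall>x\<in>V. \<bar>c * f x\<bar> \<le> B * N x"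
    by blast
  with f show "c *\<^sub>R f \<in> dual_space V N"
    by (simp add: dual_space_def distrib_left mult.left_commute)
qed

lemma dual_norm_bound:
  assumes "subspace V" "norm_on V N" "f \<in> dual_space V N" "x \<in> V"
  shows "\<bar>f x\<bar> \<le> dual_norm V N f * N x"
proof (cases "N x = 0")
  case True
  then show ?thesis
    using assms by (auto simp: dual_space_def)
next
  case False
  obtain B where B: "\<forall>x\<in>V. \<bar>f x\<bar> \<le> B * N x"
    using assms(3) by (auto simp: dual_space_def)
  have pos: "N x > 0"
    using False assms by (simp add: norm_on_def order_less_le)
  have bdd: "bdd_above ((\<lambda>x. \<bar>f x\<bar>) ` {x\<in>V. N x \<le> 1})"
  proof (rule bdd_aboveI2)
    fix y assume "y \<in> {x\<in>V. N x \<le> 1}"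
    then have "\<bar>f y\<bar> \<le> B * N y" "0 \<le> N y" "N y \<le> 1"
      using B assms(2) by (auto simp: norm_on_def)
    moreover have "B * N y \<le> \<bar>B\<bar> * N y"
      by (simp add: \<open>0 \<le> N y\<close> mult_right_mono)
    moreover have "\<bar>B\<bar> * N y \<le> \<bar>B\<bar> * 1"
      by (rule mult_left_mono) (use \<open>N y \<le> 1\<close> in auto)
    ultimately show "\<bar>f y\<bar> \<le> \<bar>B\<bar>" by simp
  qed
  let ?y = "(1 / N x) *\<^sub>R x"
  have y: "?y \<in> V"
    using assms(1,4) by (rule subspace_scale)
  have "N ?y = \<bar>1 / N x\<bar> * N x"
    using assms(2,4) unfolding norm_on_def by blast
  with pos have "N ?y = 1" by simp
  with y have "\<bar>f ?y\<bar> \<le> dual_norm V N f"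
    unfolding dual_norm_def by (intro cSUP_upper bdd) simp
  moreover have "f ?y = (1 / N x) * f x"
    using assms(3,4) by (auto simp: dual_space_def)
  ultimately show ?thesis
    using pos by (simp add: abs_mult field_simps)
qed

lemma canonical_embedding_in_bidual:
  assumes "subspace V" "norm_on V N" "x \<in> V"
  shows "canonical_embedding V N x \<in> dual_space (dual_space V N) (dual_norm V N)"
proof -
  have "\<forall>f\<in>dual_space V N. \<bar>canonical_embedding V N x f\<bar> \<le> N x * dual_norm V N f"
    using dual_norm_bound[OF assms(1,2) _ assms(3)]
    by (simp add: canonical_embedding_def mult.commute)
  then have "\<exists>B. \<forall>f\<in>dual_space V N. \<bar>canonical_embedding V N x f\<bar> \<le> B * dual_norm V N f"
    by blast
  then show ?thesis
    unfolding dual_space_def[of "dual_space V N"]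
    by (simp add: canonical_embedding_def subspace_add[OF subspace_dual_space]
        subspace_scale[OF subspace_dual_space])
qed


section \<open>Hamming metrics\<close>

text \<open>
  The list \<open>sorted_list_of_set m\<close> is the increasing enumeration of \<open>m\<close>; its positions are
  counted from 0.
\<close>

definition hamming_dist :: "nat \<Rightarrow> nat set \<Rightarrow> nat set \<Rightarrow> nat" where
  "hamming_dist k m n = card {i. i < k \<and> sorted_list_of_set m ! i \<noteq> sorted_list_of_set n ! i}"

definition hamming_metric :: "nat \<Rightarrow> nat set metric" where
  "hamming_metric k =
     metric ({m. finite m \<and> card m = k}, \<lambda>m n. real (hamming_dist k m n))"

lemma
  shows mspace_hamming_metric: "mspace (hamming_metric k) = {m. finite m \<and> card m = k}"
    and mdist_hamming_metric: "mdist (hamming_metric k) = (\<lambda>m n. real (hamming_dist k m n))"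
proof -
  interpret Metric_space "{m. finite m \<and> card m = k}" "\<lambda>m n. real (hamming_dist k m n)"
  proof
    show "0 \<le> real (hamming_dist k m n)" for m n
      by simp
    show "real (hamming_dist k m n) = real (hamming_dist k n m)" for m n
      by (simp add: hamming_dist_def eq_commute)
    show "(real (hamming_dist k m n) = 0) = (m = n)"
      if "m \<in> {m. finite m \<and> card m = k}" "n \<in> {m. finite m \<and> card m = k}" for m n
    proof
      assume "real (hamming_dist k m n) = 0"
      then have "\<forall>i<k. sorted_list_of_set m ! i = sorted_list_of_set n ! i"
        by (auto simp: hamming_dist_def)
      then have "sorted_list_of_set m = sorted_list_of_set n"
        using that by (intro nth_equalityI) auto
      then show "m = n"
        using that by (metis mem_Collect_eq set_sorted_list_of_set)
    qed (simp add: hamming_dist_def)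
    show "real (hamming_dist k l n) \<le> real (hamming_dist k l m) + real (hamming_dist k m n)"
      for l m n
    proof -
      let ?D = "\<lambda>m n. {i. i < k \<and> sorted_list_of_set m ! i \<noteq> sorted_list_of_set n ! i}"
      have "card (?D l n) \<le> card (?D l m \<union> ?D m n)"
        by (rule card_mono) auto
      also have "\<dots> \<le> card (?D l m) + card (?D m n)"
        by (rule card_Un_le)
      finally show ?thesis
        by (simp add: hamming_dist_def)
    qed
  qed
  show "mspace (hamming_metric k) = {m. finite m \<and> card m = k}"
    by (simp add: hamming_metric_def)
  show "mdist (hamming_metric k) = (\<lambda>m n. real (hamming_dist k m n))"
    by (simp add: hamming_metric_def)
qed


section \<open>Equi-coarse embeddings\<close>

text \<open>
  In \<open>ennreal\<close> the infimum of the empty set is infinite and its supremum is 0, which are the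
  conventions needed for the two moduli.
\<close>

definition compression_modulus ::
    "'a metric \<Rightarrow> 'b metric \<Rightarrow> ('a \<Rightarrow> 'b) \<Rightarrow> real \<Rightarrow> ennreal" where
  "compression_modulus X Y f t =
     Inf {ennreal (mdist Y (f x) (f y)) |x y. x \<in> mspace X \<and> y \<in> mspace X \<and> mdist X x y \<ge> t}"

definition expansion_modulus ::
    "'a metric \<Rightarrow> 'b metric \<Rightarrow> ('a \<Rightarrow> 'b) \<Rightarrow> real \<Rightarrow> ennreal" where
  "expansion_modulus X Y f t =
     Sup {ennreal (mdist Y (f x) (f y)) |x y. x \<in> mspace X \<and> y \<in> mspace X \<and> mdist X x y \<le> t}"

text \<open>
  Finiteness of \<open>\<omega>\<close> is built into its being real-valued.
\<close>

definition equi_coarsely_embeds :: "'i set \<Rightarrow> ('i \<Rightarrow> 'a metric) \<Rightarrow> 'b metric \<Rightarrow> bool" where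
  "equi_coarsely_embeds I X Y \<longleftrightarrow>
     (\<exists>(\<rho>::real \<Rightarrow> real) (\<omega>::real \<Rightarrow> real).
        (\<forall>t\<ge>0. 0 \<le> \<rho> t) \<and> (\<forall>t\<ge>0. 0 \<le> \<omega> t) \<and>
        mono_on {0..} \<rho> \<and> mono_on {0..} \<omega> \<and>
        filterlim \<rho> at_top at_top \<and>
        (\<exists>f. \<forall>i\<in>I. f i \<in> mspace (X i) \<rightarrow> mspace Y \<and>
           (\<forall>t\<ge>0. ennreal (\<rho> t) \<le> compression_modulus (X i) Y (f i) t \<and>
                  expansion_modulus (X i) Y (f i) t \<le> ennreal (\<omega> t))))"

end

theory Submission
  imports Defs
begin

text \<open>
  The space is a James-type relative of the dual of Tsirelson's space.  Call a finitely supported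
  functional a tree functional if it is \<open>\<plusminus>1\<close> on an interval, or half of a sum of at most \<open>n\<close> tree
  functionals cut down to successive intervals that start at or after position \<open>n\<close>.  Tree
  functionals norm the finitely supported vectors, and the sequences \<open>z\<close> that act on these vectors
  carry the dual norm.  The Banach space consists of the sequences of finite dual norm
  that tend to 0.  Two properties of the dual norm carry the whole proof.

  Upper estimate (\<open>norm_le_successive_pieces\<close>): if \<open>z\<close> falls into at most \<open>n\<close> successive pieces that
  start at or after \<open>n\<close>, its norm is at most twice the largest norm of a piece.  This is the rule
  for half sums of tree functionals, dualized.

  Tails (\<open>norm_le_tail_minus_lim\<close>): every sequence of finite norm converges, and after subtraction of
  its limit its tails tend to 0 in norm.  The reason is Tsirelson's: if the tails stayed large on
  vectors of coordinate sum 0, one could find such a vector \<open>y\<^sub>0\<close> and a long run of successive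
  ones after it on which \<open>z\<close> is nearly maximal.  The half sums make \<open>y\<^sub>0\<close> plus the average of the run
  have norm at most \<open>13/8\<close>, yet \<open>z\<close> takes almost twice its maximal value there.

  The space is not reflexive.  The initial indicator sequences \<open>(1,\<dots>,1,0,0,\<dots>)\<close> have norm at most 1, and
  by the upper estimate a bounded functional cannot vary by a fixed amount along them
  infinitely often.  Hence every bounded functional converges along them.  The limit is an element
  of the bidual, and a sequence representing it would have all coordinates equal to 1.

  The Hamming graphs do not embed.  Let \<open>f\<close> be a map on the \<open>k\<close>-element subsets that moves points at
  Hamming distance 1 by at most \<open>L\<close>.  Extend \<open>f\<close> to shorter lists by iterated
  generalized limits.  Choose \<open>m\<^sub>1 < n\<^sub>1 < m\<^sub>2 < n\<^sub>2 < \<dots>\<close> one at a time, and follow the difference between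
  the value at the \<open>m\<close>'s and the value at the \<open>n\<close>'s chosen so far.  Each choice changes this
  difference by at most \<open>L\<close>, and can be made so late that the change is negligible on the part
  where the difference is not yet close to a constant.  In this way \<open>f(m) - f(n)\<close> splits into \<open>2k\<close>
  successive pieces of norm at most about \<open>2L\<close>, and its norm is at most \<open>4L + 1\<close>
  (\<open>far_points_with_close_images\<close>).  But the Hamming distance of \<open>m\<close> and \<open>n\<close> is \<open>k\<close>, which is
  arbitrarily large.
\<close>

section \<open>The norming functionals\<close>

definition window :: "nat \<Rightarrow> nat \<Rightarrow> (nat \<Rightarrow> real) \<Rightarrow> nat \<Rightarrow> real" where
  "window a b z = (\<lambda>i. if a \<le> i \<and> i < b then z i else 0)"

definition tail_from :: "nat \<Rightarrow> (nat \<Rightarrow> real) \<Rightarrow> nat \<Rightarrow> real" where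
  "tail_from a z = (\<lambda>i. if a \<le> i then z i else 0)"

text \<open>
  An empty segment yields the functional 0, so a branch may also leave out some of its intervals.
  The admissibility condition \<open>n \<le> t 0\<close> is that of Tsirelson's norm.  The segments,
  in place of single coordinates, give the indicator sequences of all intervals dual norm at most 1, and
  thereby make the space non-reflexive.
\<close>

inductive tree_functional :: "(nat \<Rightarrow> real) \<Rightarrow> bool" where
  segment: "s \<in> {1, -1} \<Longrightarrow> tree_functional (window a b (\<lambda>i. s))"
| branch: "(\<And>l. l < n \<Longrightarrow> tree_functional (\<phi> l)) \<Longrightarrow> mono t \<Longrightarrow> n \<le> t 0 \<Longrightarrow>
    tree_functional (\<lambda>i. (1/2) * (\<Sum>l<n. window (t l) (t (Suc l)) (\<phi> l) i))"

lemma sum_windows_eq: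
  assumes "mono t" "l < n" "t l \<le> i" "i < t (Suc l)"
  shows "(\<Sum>m<n. window (t m) (t (Suc m)) (\<phi> m) i) = \<phi> l i"
proof -
  have "\<not> (t m \<le> i \<and> i < t (Suc m))" if "m \<noteq> l" for m
  proof (cases "m < l")
    case True
    then have "t (Suc m) \<le> t l"
      using assms(1) by (simp add: monoD)
    then show ?thesis
      using assms by simp
  next
    case False
    then have "t (Suc l) \<le> t m"
      using assms(1) that by (simp add: monoD)
    then show ?thesis
      using assms by simp
  qed
  then have "(\<Sum>m<n. window (t m) (t (Suc m)) (\<phi> m) i) = (\<Sum>m<n. if m = l then \<phi> l i else 0)"
    by (intro sum.cong) (use assms in \<open>auto simp: window_def\<close>)
  then show ?thesis
    using assms by simp
qed

lemma tree_functional_minus: "tree_functional \<phi> \<Longrightarrow> tree_functional (\<lambda>i. - \<phi> i)"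
proof (induction rule: tree_functional.induct)
  case (segment s a b)
  have "(\<lambda>i. - window a b (\<lambda>i. s) i) = window a b (\<lambda>i. - s)"
    by (auto simp: window_def)
  moreover have "tree_functional (window a b (\<lambda>i. - s))"
    using segment by (intro tree_functional.segment) auto
  ultimately show ?case
    by simp
next
  case (branch n \<phi> t)
  have "tree_functional (\<lambda>i. (1/2) * (\<Sum>l<n. window (t l) (t (Suc l)) (\<lambda>i. - \<phi> l i) i))"
    using branch by (intro tree_functional.branch)
  moreover have "(\<Sum>l<n. window (t l) (t (Suc l)) (\<lambda>i. - \<phi> l i) i) =
      - (\<Sum>l<n. window (t l) (t (Suc l)) (\<phi> l) i)" for i
    unfolding sum_negf[symmetric] by (intro sum.cong) (auto simp: window_def)
  ultimately show ?case
    by simp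
qed

lemma tree_functional_window: "tree_functional \<phi> \<Longrightarrow> tree_functional (window a b \<phi>)"
proof (induction rule: tree_functional.induct)
  case (segment s c d)
  have "window a b (window c d (\<lambda>i. s)) = window (max a c) (min b d) (\<lambda>i. s)"
    by (auto simp: window_def)
  then show ?case
    using segment tree_functional.segment by metis
next
  case (branch n \<phi> t)
  have "tree_functional (\<lambda>i. (1/2) * (\<Sum>l<n. window (t l) (t (Suc l)) (window a b (\<phi> l)) i))"
    using branch by (intro tree_functional.branch)
  moreover have "(\<lambda>i. (1/2) * (\<Sum>l<n. window (t l) (t (Suc l)) (window a b (\<phi> l)) i)) =
      window a b (\<lambda>i. (1/2) * (\<Sum>l<n. window (t l) (t (Suc l)) (\<phi> l) i))"
    by (auto simp: window_def fun_eq_iff intro!: sum.cong sum.neutral)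
  ultimately show ?case
    by simp
qed

lemma tree_functional_abs_le_1: "tree_functional \<phi> \<Longrightarrow> \<bar>\<phi> i\<bar> \<le> 1"
proof (induction rule: tree_functional.induct)
  case (segment s a b)
  then show ?case
    by (auto simp: window_def)
next
  case (branch n \<phi> t)
  show ?case
  proof (cases "\<exists>l<n. t l \<le> i \<and> i < t (Suc l)")
    case True
    then obtain l where l: "l < n" "t l \<le> i" "i < t (Suc l)"
      by blast
    show ?thesis
      using sum_windows_eq[OF branch.hyps(2) l, of \<phi>] branch.IH[OF l(1)] by (simp add: abs_mult)
  next
    case False
    then have "(\<Sum>l<n. window (t l) (t (Suc l)) (\<phi> l) i) = 0"
      by (auto simp: window_def intro!: sum.neutral)
    then show ?thesis
      by simp
  qed
qed

lemma tree_functional_0: "tree_functional (\<lambda>i. 0)"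
proof -
  have "window 0 0 (\<lambda>i. 1) = (\<lambda>i. 0)"
    by (auto simp: window_def)
  then show ?thesis
    using segment[of 1 0 0] by simp
qed


section \<open>The dual norm\<close>

text \<open>
  A finitely supported vector is given by a sequence \<open>y\<close> and a length \<open>n\<close>; the values of \<open>y\<close> from
  \<open>n\<close> on are ignored.
\<close>

definition pairing :: "nat \<Rightarrow> (nat \<Rightarrow> real) \<Rightarrow> (nat \<Rightarrow> real) \<Rightarrow> real" where
  "pairing n z y = (\<Sum>i<n. z i * y i)"

definition in_ball :: "nat \<Rightarrow> (nat \<Rightarrow> real) \<Rightarrow> bool" where
  "in_ball n y \<longleftrightarrow> (\<forall>\<phi>. tree_functional \<phi> \<longrightarrow> pairing n \<phi> y \<le> 1)"

text \<open>
  The dual norm is first used through its upper bounds.  They make sense for every sequence,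
  including those of infinite norm, and in particular for coordinatewise limits.
\<close>

definition norm_le :: "(nat \<Rightarrow> real) \<Rightarrow> real \<Rightarrow> bool" where
  "norm_le z C \<longleftrightarrow> (\<forall>n y. in_ball n y \<longrightarrow> pairing n z y \<le> C)"

lemma pairing_add_left: "pairing n (\<lambda>i. z i + w i) y = pairing n z y + pairing n w y"
  by (simp add: pairing_def distrib_right sum.distrib)

lemma pairing_add_right: "pairing n z (\<lambda>i. y i + x i) = pairing n z y + pairing n z x"
  by (simp add: pairing_def distrib_left sum.distrib)

lemma pairing_scale_left: "pairing n (\<lambda>i. c * z i) y = c * pairing n z y"
  by (simp add: pairing_def sum_distrib_left mult.assoc)

lemma pairing_scale_right: "pairing n z (\<lambda>i. c * y i) = c * pairing n z y"
  by (simp add: pairing_def sum_distrib_left algebra_simps)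

lemma pairing_sum_right: "pairing n z (\<lambda>i. \<Sum>l\<in>A. y l i) = (\<Sum>l\<in>A. pairing n z (y l))"
  unfolding pairing_def sum_distrib_left by (rule sum.swap)

lemma pairing_sum_left: "pairing n (\<lambda>i. \<Sum>l\<in>A. z l i) y = (\<Sum>l\<in>A. pairing n (z l) y)"
  unfolding pairing_def sum_distrib_right by (rule sum.swap)

lemma pairing_window_swap: "pairing n (window a b z) y = pairing n z (window a b y)"
  unfolding pairing_def by (intro sum.cong) (auto simp: window_def)

lemma pairing_minus_left: "pairing n (\<lambda>i. - z i) y = - pairing n z y"
  by (simp add: pairing_def sum_negf)

lemma pairing_minus_right: "pairing n z (\<lambda>i. - y i) = - pairing n z y"
  by (simp add: pairing_def sum_negf)

lemma pairing_extend:
  assumes "m \<le> n" "\<And>i. m \<le> i \<Longrightarrow> y i = 0"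
  shows "pairing n z y = pairing m z y"
  unfolding pairing_def by (rule sum.mono_neutral_right) (use assms in auto)

lemma in_ball_minus:
  assumes "in_ball n y"
  shows "in_ball n (\<lambda>i. - y i)"
  unfolding in_ball_def
proof (intro allI impI)
  fix \<phi> assume "tree_functional \<phi>"
  then have "pairing n (\<lambda>i. - \<phi> i) y \<le> 1"
    using assms tree_functional_minus unfolding in_ball_def by blast
  then show "pairing n \<phi> (\<lambda>i. - y i) \<le> 1"
    by (simp add: pairing_minus_left pairing_minus_right)
qed

lemma in_ball_window: "in_ball n y \<Longrightarrow> in_ball n (window a b y)"
  by (simp add: in_ball_def pairing_window_swap[symmetric] tree_functional_window)

lemma in_ball_unit: "in_ball n (\<lambda>i. if i = j then 1 else 0)"
  unfolding in_ball_def
proof (intro allI impI)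
  fix \<phi> assume "tree_functional \<phi>"
  then have "\<bar>\<phi> j\<bar> \<le> 1"
    by (rule tree_functional_abs_le_1)
  then show "pairing n \<phi> (\<lambda>i. if i = j then 1 else 0) \<le> 1"
    by (auto simp: pairing_def if_distrib cong: if_cong)
qed

lemma in_ball_0: "in_ball n (\<lambda>i. 0)"
  by (simp add: in_ball_def pairing_def)

lemma norm_le_nonneg: "norm_le z C \<Longrightarrow> 0 \<le> C"
  using in_ball_0[of 0] by (force simp: norm_le_def pairing_def)

lemma norm_le_mono: "norm_le z C \<Longrightarrow> C \<le> D \<Longrightarrow> norm_le z D"
  by (force simp: norm_le_def)

lemma norm_le_abs: "norm_le z C \<Longrightarrow> in_ball n y \<Longrightarrow> \<bar>pairing n z y\<bar> \<le> C"
  using in_ball_minus[of n y] unfolding norm_le_def abs_le_iff pairing_minus_right[symmetric] by blast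

lemma norm_le_scale: "norm_le z C \<Longrightarrow> norm_le (\<lambda>i. c * z i) (\<bar>c\<bar> * C)"
proof -
  assume z: "norm_le z C"
  have "c * pairing n z y \<le> \<bar>c\<bar> * C" if "in_ball n y" for n y
  proof -
    have "c * pairing n z y \<le> \<bar>c\<bar> * \<bar>pairing n z y\<bar>"
      by (metis abs_ge_self abs_mult)
    also have "\<dots> \<le> \<bar>c\<bar> * C"
      using norm_le_abs[OF z that] by (simp add: mult_left_mono)
    finally show ?thesis .
  qed
  then show ?thesis
    by (simp add: norm_le_def pairing_scale_left)
qed

lemma norm_le_add: "norm_le z C \<Longrightarrow> norm_le w D \<Longrightarrow> norm_le (\<lambda>i. z i + w i) (C + D)"
  by (auto simp: norm_le_def pairing_add_left intro: add_mono)

lemma norm_le_minus: "norm_le z C \<Longrightarrow> norm_le (\<lambda>i. - z i) C"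
  using norm_le_scale[of z C "-1"] by simp

lemma norm_le_diff: "norm_le z C \<Longrightarrow> norm_le w D \<Longrightarrow> norm_le (\<lambda>i. z i - w i) (C + D)"
  using norm_le_add[OF _ norm_le_minus, of z C w D] by simp

lemma norm_le_window: "norm_le z C \<Longrightarrow> norm_le (window a b z) C"
  by (simp add: norm_le_def pairing_window_swap in_ball_window)

lemma norm_le_coordinate:
  assumes "norm_le z C"
  shows "\<bar>z j\<bar> \<le> C"
  using norm_le_abs[OF assms in_ball_unit[of "Suc j" j]]
  by (simp add: pairing_def if_distrib cong: if_cong)

lemma norm_le_tree_functional: "tree_functional \<phi> \<Longrightarrow> norm_le \<phi> 1"
  by (auto simp: norm_le_def in_ball_def)

text \<open>
  The dual norm is lower semicontinuous under coordinatewise convergence, because every test vector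
  sees only finitely many coordinates.  All later passages to a limit rest on this lemma.
\<close>

lemma norm_le_finite_approx:
  assumes "\<And>q e. e > 0 \<Longrightarrow> \<exists>w. norm_le w C \<and> (\<forall>i<q. \<bar>z i - w i\<bar> < e)"
  shows "norm_le z C"
  unfolding norm_le_def
proof (intro allI impI)
  fix n y assume y: "in_ball n y"
  show "pairing n z y \<le> C"
  proof (rule field_le_epsilon)
    fix e :: real assume e: "e > 0"
    define s where "s = (\<Sum>i<n. \<bar>y i\<bar>)"
    have s: "s \<ge> 0"
      by (simp add: s_def sum_nonneg)
    obtain w where w: "norm_le w C" "\<forall>i<n. \<bar>z i - w i\<bar> < e / (s + 1)"
      using assms[of "e / (s + 1)" n] e s by auto
    have "pairing n z y - pairing n w y = (\<Sum>i<n. (z i - w i) * y i)"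
      by (simp add: pairing_def left_diff_distrib sum_subtractf)
    also have "\<dots> \<le> (\<Sum>i<n. (e / (s + 1)) * \<bar>y i\<bar>)"
    proof (rule sum_mono)
      fix i assume i: "i \<in> {..<n}"
      have "(z i - w i) * y i \<le> \<bar>z i - w i\<bar> * \<bar>y i\<bar>"
        by (metis abs_ge_self abs_mult)
      also have "\<dots> \<le> (e / (s + 1)) * \<bar>y i\<bar>"
        using w(2) i by (intro mult_right_mono) auto
      finally show "(z i - w i) * y i \<le> (e / (s + 1)) * \<bar>y i\<bar>" .
    qed
    also have "\<dots> = e * (s / (s + 1))"
      unfolding sum_distrib_left[symmetric] s_def[symmetric] by simp
    also have "\<dots> \<le> e * 1"
      using e s by (intro mult_left_mono) auto
    finally show "pairing n z y \<le> C + e"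
      using w(1) y by (force simp: norm_le_def)
  qed
qed

lemma norm_le_const: "norm_le (\<lambda>i. c) \<bar>c\<bar>"
proof -
  have "norm_le (\<lambda>i. 1) 1"
  proof (rule norm_le_finite_approx)
    fix q and e :: real assume "e > 0"
    then show "\<exists>w. norm_le w 1 \<and> (\<forall>i<q. \<bar>1 - w i\<bar> < e)"
      using norm_le_tree_functional[OF segment[of 1 0 q]]
      by (auto simp: window_def intro!: exI[of _ "window 0 q (\<lambda>i. 1)"])
  qed
  from norm_le_scale[OF this, of c] show ?thesis
    by simp
qed

lemma norm_le_window_0_small:
  assumes "\<And>i. i < q \<Longrightarrow> \<bar>z i\<bar> \<le> d"
  shows "norm_le (window 0 q z) (real q * d)"
  using assms
proof (induction q)
  case 0
  have "window 0 0 z = (\<lambda>i. 0)"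
    by (auto simp: window_def)
  then show ?case
    using norm_le_const[of 0] by simp
next
  case (Suc q)
  have "norm_le (\<lambda>i. window 0 q z i + z q * window q (Suc q) (\<lambda>i. 1) i) (real q * d + \<bar>z q\<bar> * 1)"
    by (intro norm_le_add norm_le_scale norm_le_tree_functional segment Suc) auto
  moreover have "(\<lambda>i. window 0 q z i + z q * window q (Suc q) (\<lambda>i. 1) i) = window 0 (Suc q) z"
    by (auto simp: window_def less_Suc_eq)
  moreover have "real q * d + \<bar>z q\<bar> * 1 \<le> real (Suc q) * d"
    using Suc.prems[of q] by (simp add: algebra_simps)
  ultimately show ?case
    using norm_le_mono by metis
qed

text \<open>
  For a test vector \<open>y\<close> of arbitrary norm, \<open>pairing n z y \<le> C * (SUP \<phi>. pairing n \<phi> y)\<close>.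
  Replacing the supremum by a single \<open>\<phi>\<close> up to \<open>d\<close> lets the next proof assemble the functionals chosen on
  different intervals into one branch.
\<close>

lemma norm_almost_attained_by_tree_functional:
  assumes "norm_le z C" "C > 0" "d > 0"
  obtains \<phi> where "tree_functional \<phi>" "pairing n z y \<le> C * pairing n \<phi> y + d"
proof (rule ccontr)
  assume neg: "\<not> thesis"
  have *: "C * pairing n \<phi> y + d < pairing n z y" if \<phi>: "tree_functional \<phi>" for \<phi>
  proof (rule ccontr)
    assume "\<not> ?thesis"
    then have "pairing n z y \<le> C * pairing n \<phi> y + d"
      by simp
    then show False
      using neg \<phi> \<open>\<And>\<phi>. tree_functional \<phi> \<Longrightarrow> pairing n z y \<le> C * pairing n \<phi> y + d \<Longrightarrow> thesis\<close>
      by simp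
  qed
  define p where "p = (pairing n z y - d) / C"
  have p: "pairing n \<phi> y < p" if "tree_functional \<phi>" for \<phi>
    using *[OF that] assms(2) by (simp add: p_def field_simps)
  then have "p > 0"
    using tree_functional_0 by (force simp: pairing_def)
  then have "in_ball n (\<lambda>i. (1/p) * y i)"
    unfolding in_ball_def pairing_scale_right using p by (force simp: field_simps)
  then have "(1/p) * pairing n z y \<le> C"
    using assms(1) unfolding norm_le_def pairing_scale_right[symmetric] by blast
  then have "pairing n z y \<le> C * p"
    using \<open>p > 0\<close> by (simp add: field_simps)
  then show False
    using assms by (simp add: p_def)
qed

lemma window_eq_sum_windows:
  assumes "mono t"
  shows "window (t 0) (t r) z i = (\<Sum>l<r. window (t l) (t (Suc l)) z i)"
proof (induction r)
  case 0
  then show ?case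
    by (simp add: window_def)
next
  case (Suc r)
  have "t 0 \<le> t r" "t r \<le> t (Suc r)"
    using assms by (simp_all add: monoD)
  then have "window (t 0) (t (Suc r)) z i = window (t 0) (t r) z i + window (t r) (t (Suc r)) z i"
    by (auto simp: window_def)
  then show ?case
    by (simp add: Suc)
qed

text \<open>
  On each interval choose a tree functional that almost norms the part of the test vector there.
  Half the sum of these functionals is again a tree functional, hence at most 1 on the test
  vector; the factor 2 undoes the half.
\<close>

lemma norm_le_successive_pieces:
  assumes t: "mono t" "r \<le> t 0"
    and pieces: "\<And>l. l < r \<Longrightarrow> norm_le (window (t l) (t (Suc l)) z) C"
    and C: "C \<ge> 0"
  shows "norm_le (window (t 0) (t r) z) (2 * C)"
proof -
  have bound: "norm_le (window (t 0) (t r) z) (2 * D)" if D: "D > C" for D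
    unfolding norm_le_def
  proof (intro allI impI)
    fix n y assume y: "in_ball n y"
    show "pairing n (window (t 0) (t r) z) y \<le> 2 * D"
    proof (rule field_le_epsilon)
      fix e :: real assume e: "e > 0"
      define d where "d = e / (real r + 1)"
      have d: "d > 0" "real r * d \<le> e"
        using e by (auto simp: d_def field_simps)
      have "\<exists>\<phi>. tree_functional \<phi> \<and>
          pairing n (window (t l) (t (Suc l)) z) (window (t l) (t (Suc l)) y) \<le>
          D * pairing n \<phi> (window (t l) (t (Suc l)) y) + d" if "l < r" for l
      proof -
        have "norm_le (window (t l) (t (Suc l)) z) D"
          using pieces[OF that] D by (auto elim: norm_le_mono)
        then show ?thesis
          using norm_almost_attained_by_tree_functional[of _ D d n "window (t l) (t (Suc l)) y"] C D d(1)
          by (metis le_less_trans)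
      qed
      then obtain \<phi> where \<phi>: "\<And>l. l < r \<Longrightarrow> tree_functional (\<phi> l)"
        "\<And>l. l < r \<Longrightarrow> pairing n (window (t l) (t (Suc l)) z) (window (t l) (t (Suc l)) y) \<le>
          D * pairing n (\<phi> l) (window (t l) (t (Suc l)) y) + d"
        by metis
      have idem: "window a b (window a b z) = window a b z" for a b
        by (auto simp: window_def)
      have "pairing n (window (t 0) (t r) z) y = (\<Sum>l<r. pairing n (window (t l) (t (Suc l)) z) y)"
        unfolding pairing_sum_left[symmetric]
        by (simp add: window_eq_sum_windows[OF t(1), symmetric])
      also have "\<dots> \<le> (\<Sum>l<r. D * pairing n (window (t l) (t (Suc l)) (\<phi> l)) y + d)"
        using \<phi>(2) by (intro sum_mono) (simp add: idem pairing_window_swap[symmetric])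
      also have "\<dots> = 2 * D * pairing n (\<lambda>i. (1/2) * (\<Sum>l<r. window (t l) (t (Suc l)) (\<phi> l) i)) y + real r * d"
        by (simp only: pairing_scale_left pairing_sum_left sum.distrib sum_distrib_left[symmetric]) simp
      also have "\<dots> \<le> 2 * D * 1 + e"
      proof -
        have "tree_functional (\<lambda>i. (1/2) * (\<Sum>l<r. window (t l) (t (Suc l)) (\<phi> l) i))"
          using \<phi>(1) t by (rule branch)
        then have "pairing n (\<lambda>i. (1/2) * (\<Sum>l<r. window (t l) (t (Suc l)) (\<phi> l) i)) y \<le> 1"
          using y unfolding in_ball_def by blast
        then show ?thesis
          using C D d by (intro add_mono mult_left_mono) auto
      qed
      finally show "pairing n (window (t 0) (t r) z) y \<le> 2 * D + e"
        by simp
    qed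
  qed
  show ?thesis
    unfolding norm_le_def
  proof (intro allI impI, rule field_le_epsilon)
    fix n y and e :: real assume y: "in_ball n y" and e: "e > 0"
    have "norm_le (window (t 0) (t r) z) (2 * (C + e/2))"
      using e by (intro bound) simp
    with y show "pairing n (window (t 0) (t r) z) y \<le> 2 * C + e"
      unfolding norm_le_def by (simp add: distrib_left)
  qed
qed


section \<open>Tails are constant up to small norm\<close>

text \<open>
  A tree functional has few breakpoints or starts late.  On a vector supported between two
  breakpoints, a branch acts as half of a single tree functional or as 0, and a segment
  acts as a multiple of the coordinate sum or as 0.
\<close>

lemma pairing_le_half_between_breakpoints:
  assumes \<phi>: "tree_functional \<phi>"
  obtains T where "finite T"
    "card T \<le> N + 2 \<or> (\<forall>i<N. \<phi> i = 0)"
    "\<And>a b n y. \<lbrakk>in_ball n y; (\<Sum>i<n. y i) = 0; \<And>i. y i \<noteq> 0 \<Longrightarrow> a \<le> i \<and> i < b;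
       \<And>u. u \<in> T \<Longrightarrow> \<not> (a < u \<and> u < b)\<rbrakk> \<Longrightarrow> pairing n \<phi> y \<le> 1/2"
  using \<phi>
proof cases
  case (segment s c d)
  have "pairing n \<phi> y \<le> 1/2"
    if y: "(\<Sum>i<n. y i) = 0" "\<And>i. y i \<noteq> 0 \<Longrightarrow> a \<le> i \<and> i < b"
      and T: "\<And>u. u \<in> {c, d} \<Longrightarrow> \<not> (a < u \<and> u < b)" for a b n y
  proof (cases "c \<le> a \<and> b \<le> d")
    case True
    have "pairing n \<phi> y = (\<Sum>i<n. s * y i)"
      unfolding pairing_def using True y(2) by (intro sum.cong) (force simp: segment window_def)+
    then show ?thesis
      using y(1) by (simp add: sum_distrib_left[symmetric])
  next
    case False
    then have "b \<le> c \<or> d \<le> a \<or> b \<le> a"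
      using T[of c] T[of d] by auto
    then have "pairing n \<phi> y = 0"
      unfolding pairing_def using y(2) by (intro sum.neutral) (force simp: segment window_def)
    then show ?thesis
      by simp
  qed
  moreover have "card {c, d} \<le> N + 2"
    by (simp add: card_insert_if)
  ultimately show ?thesis
    by (intro that[of "{c, d}"]) auto
next
  case (branch m \<psi> t)
  have mono: "mono t"
    by (rule branch)
  have half: "pairing n \<phi> y \<le> 1/2"
    if y: "in_ball n y" "\<And>i. y i \<noteq> 0 \<Longrightarrow> a \<le> i \<and> i < b"
      and T: "\<And>u. u \<in> t ` {..m} \<Longrightarrow> \<not> (a < u \<and> u < b)" for a b n y
  proof (cases "\<exists>l<m. t l \<le> a \<and> b \<le> t (Suc l)")
    case True
    then obtain l where l: "l < m" "t l \<le> a" "b \<le> t (Suc l)"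
      by blast
    have "pairing n \<phi> y = pairing n (\<lambda>i. (1/2) * \<psi> l i) y"
      unfolding pairing_def
    proof (intro sum.cong refl)
      fix i
      show "\<phi> i * y i = (1/2) * \<psi> l i * y i"
      proof (cases "y i = 0")
        case False
        then have i: "t l \<le> i" "i < t (Suc l)"
          using y(2)[of i] l by auto
        have "(\<Sum>l<m. window (t l) (t (Suc l)) (\<psi> l) i) = \<psi> l i"
          using mono l(1) i by (rule sum_windows_eq)
        then show ?thesis
          by (simp add: branch)
      qed simp
    qed
    also have "\<dots> \<le> (1/2) * 1"
      unfolding pairing_scale_left using y(1) branch(2)[OF l(1)]
      by (intro mult_left_mono) (auto simp: in_ball_def)
    finally show ?thesis
      by simp
  next
    case False
    have zero: "\<phi> i * y i = 0" for i
    proof (cases "y i = 0")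
      case False
      then have i: "a \<le> i" "i < b"
        using y(2) by auto
      have "window (t l) (t (Suc l)) (\<psi> l) i = 0" if l: "l < m" for l
      proof (rule ccontr)
        assume "window (t l) (t (Suc l)) (\<psi> l) i \<noteq> 0"
        then have "t l \<le> i" "i < t (Suc l)"
          by (auto simp: window_def split: if_splits)
        moreover have "\<not> (a < t l \<and> t l < b)" "\<not> (a < t (Suc l) \<and> t (Suc l) < b)"
          using T[of "t l"] T[of "t (Suc l)"] l by auto
        ultimately have "t l \<le> a \<and> b \<le> t (Suc l)"
          using i by auto
        then show False
          using \<open>\<not> (\<exists>l<m. t l \<le> a \<and> b \<le> t (Suc l))\<close> l by blast
      qed
      then show ?thesis
        by (simp add: branch)
    qed simp
    show ?thesis
      by (simp add: pairing_def zero)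
  qed
  have small: "card (t ` {..m}) \<le> N + 2 \<or> (\<forall>i<N. \<phi> i = 0)"
  proof (cases "m \<le> N")
    case True
    have "card (t ` {..m}) \<le> card {..m}"
      by (rule card_image_le) simp
    with True show ?thesis
      by simp
  next
    case False
    have "\<phi> i = 0" if "i < N" for i
    proof -
      have "t 0 \<le> t l" for l
        using mono by (simp add: monoD)
      then have "window (t l) (t (Suc l)) (\<psi> l) i = 0" for l
        using that False branch(4) unfolding window_def by (metis leD le_trans less_imp_le not_le)
      then show ?thesis
        by (simp add: branch)
    qed
    then show ?thesis
      by blast
  qed
  show ?thesis
  proof (rule that[OF _ small])
    show "pairing n \<phi> y \<le> 1/2"
      if "in_ball n y" "(\<Sum>i<n. y i) = 0" "\<And>i. y i \<noteq> 0 \<Longrightarrow> a \<le> i \<and> i < b"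
        "\<And>u. u \<in> t ` {..m} \<Longrightarrow> \<not> (a < u \<and> u < b)" for a b n y
      using that(1,3,4) by (rule half)
  qed simp
qed

text \<open>
  Each breakpoint spoils at most one of the successive vectors, and on a spoilt vector the
  functional is still at most 1.
\<close>

lemma sum_pairing_successive_le:
  assumes "tree_functional \<phi>" "mono s"
    and ball: "\<And>i. in_ball n (Y i)" and zero: "\<And>i. (\<Sum>j<n. Y i j) = 0"
    and supp: "\<And>i j. Y i j \<noteq> 0 \<Longrightarrow> s i \<le> j \<and> j < s (Suc i)"
  shows "(\<Sum>i=1..r. pairing n \<phi> (Y i)) \<le> real r / 2 + (real (s 1) + 2) \<or> (\<forall>i<s 1. \<phi> i = 0)"
proof -
  obtain T where T: "finite T" "card T \<le> s 1 + 2 \<or> (\<forall>i<s 1. \<phi> i = 0)"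
    "\<And>a b n y. \<lbrakk>in_ball n y; (\<Sum>i<n. y i) = 0; \<And>i. y i \<noteq> 0 \<Longrightarrow> a \<le> i \<and> i < b;
       \<And>u. u \<in> T \<Longrightarrow> \<not> (a < u \<and> u < b)\<rbrakk> \<Longrightarrow> pairing n \<phi> y \<le> 1/2"
    using pairing_le_half_between_breakpoints[OF assms(1), of "s 1"] by blast
  define bad where "bad = {i \<in> {1..r}. \<exists>u\<in>T. s i < u \<and> u < s (Suc i)}"
  have "\<forall>i\<in>bad. \<exists>u\<in>T. s i < u \<and> u < s (Suc i)"
    by (simp add: bad_def)
  then obtain g where g: "\<And>i. i \<in> bad \<Longrightarrow> g i \<in> T \<and> s i < g i \<and> g i < s (Suc i)"
    by metis
  have "inj_on g bad"
  proof (rule linorder_inj_onI')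
    fix i j assume ij: "i \<in> bad" "j \<in> bad" "i < j"
    then have "s (Suc i) \<le> s j"
      using assms(2) by (simp add: monoD)
    then show "g i \<noteq> g j"
      using g[OF ij(1)] g[OF ij(2)] by simp
  qed
  then have card_bad: "card bad \<le> card T"
    using g T(1) by (intro card_inj_on_le[of g]) auto
  have "(\<Sum>i=1..r. pairing n \<phi> (Y i)) \<le> (\<Sum>i=1..r. 1/2 + (if i \<in> bad then 1 else 0))"
  proof (rule sum_mono)
    fix i assume i: "i \<in> {1..r}"
    show "pairing n \<phi> (Y i) \<le> 1/2 + (if i \<in> bad then 1 else 0)"
    proof (cases "i \<in> bad")
      case True
      have "pairing n \<phi> (Y i) \<le> 1"
        using ball assms(1) by (auto simp: in_ball_def)
      with True show ?thesis
        by simp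
    next
      case False
      then have "pairing n \<phi> (Y i) \<le> 1/2"
        using i by (intro T(3)[OF ball zero, of i "s i" "s (Suc i)"] supp) (auto simp: bad_def)
      with False show ?thesis
        by simp
    qed
  qed
  also have "\<dots> = real r / 2 + real (card bad)"
  proof -
    have "bad \<subseteq> {1..r}"
      by (auto simp: bad_def)
    then have "{1..r} \<inter> bad = bad"
      by blast
    then show ?thesis
      by (simp add: sum.distrib sum.If_cases)
  qed
  finally have *: "(\<Sum>i=1..r. pairing n \<phi> (Y i)) \<le> real r / 2 + real (card bad)" .
  show ?thesis
    using T(2)
  proof
    assume "card T \<le> s 1 + 2"
    then have "real (card bad) \<le> real (s 1 + 2)"
      using card_bad by (simp only: of_nat_le_iff)
    with * show ?thesis
      by simp
  qed blast
qed

lemma in_ball_extend: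
  assumes "in_ball m y" "m \<le> n" "\<And>i. m \<le> i \<Longrightarrow> y i = 0"
  shows "in_ball n y"
  using assms by (simp add: in_ball_def pairing_extend)

text \<open>
  Vectors with coordinate sum 0 do not see constants, so this bounds the norm of the tail of \<open>z\<close>
  modulo constant sequences.
\<close>

definition flat_tail_bound :: "(nat \<Rightarrow> real) \<Rightarrow> nat \<Rightarrow> real \<Rightarrow> bool" where
  "flat_tail_bound z q c \<longleftrightarrow>
     (\<forall>n y. in_ball n y \<longrightarrow> (\<Sum>i<n. y i) = 0 \<longrightarrow> (\<forall>i<q. y i = 0) \<longrightarrow> pairing n z y \<le> c)"

text \<open>
  If \<open>z\<close> exceeds \<open>9/10 * c\<close> on flat vectors arbitrarily far out, take \<open>Y 0\<close> and \<open>r\<close> successive further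
  such vectors.  A tree functional that meets \<open>Y 0\<close> has at most \<open>s 1 + 2\<close> breakpoints, which
  do not matter for the average over \<open>r = 8 * (s 1 + 2)\<close> vectors: that average contributes at most
  \<open>1/2 + 1/8\<close>.  So \<open>Y 0\<close> plus the average has norm at most \<open>13/8\<close>, whereas \<open>z\<close> is more than \<open>18/10 * c\<close> on it.
\<close>

lemma flat_tail_bound_shrink:
  assumes bound: "flat_tail_bound z q c" and c: "c > 0"
  shows "\<exists>q'. flat_tail_bound z q' (9/10 * c)"
proof (rule ccontr)
  assume neg: "\<not> ?thesis"
  define good where "good p n y \<longleftrightarrow> p \<le> n \<and> in_ball n y \<and> (\<Sum>i<n. y i) = 0 \<and> (\<forall>i. y i \<noteq> 0 \<longrightarrow> p \<le> i \<and> i < n) \<and>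
      9/10 * c < pairing n z y" for p n y
  have "\<exists>n y. good p n y" for p
  proof -
    obtain n y where y: "in_ball n y" "(\<Sum>i<n. y i) = 0" "\<forall>i<p. y i = 0" "9/10 * c < pairing n z y"
      using neg unfolding flat_tail_bound_def by (meson not_le)
    define x where "x = window 0 n y"
    have x: "\<And>i. n \<le> i \<Longrightarrow> x i = 0"
      by (simp add: x_def window_def)
    have ball: "in_ball n x"
      unfolding x_def using y(1) by (rule in_ball_window)
    have eq: "pairing n w x = pairing n w y" for w
      unfolding pairing_def by (intro sum.cong) (auto simp: x_def window_def)
    have "(\<Sum>i<n. x i) = 0"
      using eq[of "\<lambda>i. 1"] y(2) by (simp add: pairing_def)
    then have "(\<Sum>i<max n p. x i) = 0"
      using pairing_extend[of n "max n p" x "\<lambda>i. 1"] x by (simp add: pairing_def)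
    moreover have "in_ball (max n p) x"
      using in_ball_extend[OF ball] x by simp
    moreover have "pairing (max n p) z x = pairing n z y"
      using pairing_extend[of n "max n p" x z] x eq by simp
    moreover have "\<forall>i. x i \<noteq> 0 \<longrightarrow> p \<le> i \<and> i < max n p"
      using y(3) by (auto simp: x_def window_def not_less[symmetric] split: if_splits)
    ultimately show ?thesis
      unfolding good_def using y(4) by (intro exI[of _ "max n p"] exI[of _ x]) simp
  qed
  then obtain nn yy where "\<And>p. good p (nn p) (yy p)"
    by metis
  then have yy: "\<And>p. p \<le> nn p" "\<And>p. in_ball (nn p) (yy p)"
    "\<And>p. (\<Sum>i<nn p. yy p i) = 0" "\<And>p i. yy p i \<noteq> 0 \<Longrightarrow> p \<le> i \<and> i < nn p"
    "\<And>p. 9/10 * c < pairing (nn p) z (yy p)"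
    unfolding good_def by blast+
  define s where "s i = (nn ^^ i) q" for i
  have s_Suc: "s (Suc i) = nn (s i)" and s_0: "s 0 = q" for i
    by (simp_all add: s_def)
  have mono: "mono s"
    by (simp add: mono_iff_le_Suc s_Suc yy(1))
  \<comment> \<open>The bound \<open>s 1\<close> on the support of \<open>Y 0\<close> limits the breakpoints of the functionals that meet \<open>Y 0\<close>.\<close>
  define r where "r = 8 * (s 1 + 2)"
  define M where "M = s (Suc r)"
  have le_M: "s (Suc i) \<le> M" if "i \<le> r" for i
    unfolding M_def using mono that by (simp add: monoD)
  define Y where "Y i = (if i \<le> r then yy (s i) else (\<lambda>j. 0))" for i
  have supp: "s i \<le> j \<and> j < s (Suc i)" if "Y i j \<noteq> 0" for i j
    using that yy(4)[of "s i" j] by (auto simp: Y_def s_Suc split: if_splits)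
  have ext: "pairing M w (Y i) = pairing (nn (s i)) w (yy (s i))" if "i \<le> r" for i w
  proof -
    have "yy (s i) j = 0" if "nn (s i) \<le> j" for j
      using yy(4)[of "s i" j] that by (meson leD)
    then show ?thesis
      using that le_M[OF that] by (simp add: Y_def s_Suc pairing_extend)
  qed
  have ball: "in_ball M (Y i)" for i
  proof (cases "i \<le> r")
    case True
    then show ?thesis
      using yy(2)[of "s i"] by (simp add: in_ball_def ext)
  qed (simp add: Y_def in_ball_0)
  have zero: "(\<Sum>j<M. Y i j) = 0" for i
  proof (cases "i \<le> r")
    case True
    then show ?thesis
      using ext[OF True, of "\<lambda>j. 1"] yy(3)[of "s i"] by (simp add: pairing_def)
  qed (simp add: Y_def)
  have r: "r > 0" "real (s 1) + 2 = real r / 8"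
    by (auto simp: r_def)
  define u where "u j = Y 0 j + (1 / real r) * (\<Sum>i=1..r. Y i j)" for j
  have pairing_u: "pairing M w u = pairing M w (Y 0) + (1 / real r) * (\<Sum>i=1..r. pairing M w (Y i))" for w
    unfolding u_def pairing_add_right pairing_scale_right pairing_sum_right ..
  have "in_ball M (\<lambda>j. (8/13) * u j)"
    unfolding in_ball_def
  proof (intro allI impI)
    fix \<phi> assume \<phi>: "tree_functional \<phi>"
    have each: "pairing M \<phi> (Y i) \<le> 1" for i
      using ball \<phi> by (auto simp: in_ball_def)
    have "pairing M \<phi> u \<le> 13/8"
    proof (cases "\<forall>i<s 1. \<phi> i = 0")
      case True
      then have "pairing M \<phi> (Y 0) = 0"
        unfolding pairing_def using supp[of 0] by (intro sum.neutral) (metis One_nat_def mult_zero_left mult_zero_right)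
      moreover have "(\<Sum>i=1..r. pairing M \<phi> (Y i)) \<le> (\<Sum>i=1..r. 1)"
        using each by (intro sum_mono)
      ultimately show ?thesis
        using r by (simp add: pairing_u field_simps)
    next
      case False
      then have "(\<Sum>i=1..r. pairing M \<phi> (Y i)) \<le> real r / 2 + (real (s 1) + 2)"
        using sum_pairing_successive_le[where s = s and Y = Y and n = M and r = r, OF \<phi> mono ball zero supp]
      by blast
      then have "(1 / real r) * (\<Sum>i=1..r. pairing M \<phi> (Y i)) \<le> 5/8"
        using r by (simp add: field_simps)
      then show ?thesis
        using each[of 0] by (simp add: pairing_u)
    qed
    then show "pairing M \<phi> (\<lambda>j. (8/13) * u j) \<le> 1"
      by (simp only: pairing_scale_right)
  qed
  moreover have "(\<Sum>j<M. (8/13) * u j) = 0"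
  proof -
    have "pairing M (\<lambda>j. 1) (Y i) = 0" for i
      using zero by (simp add: pairing_def)
    then have "pairing M (\<lambda>j. 1) u = 0"
      by (simp add: pairing_u)
    then show ?thesis
      unfolding sum_distrib_left[symmetric] by (simp add: pairing_def)
  qed
  moreover have "\<forall>j<q. (8/13) * u j = 0"
  proof (intro allI impI)
    fix j assume "j < q"
    then have "Y i j = 0" for i
      using supp[of i j] monoD[OF mono, of 0 i] s_0 by (meson leD le_trans zero_le)
    then show "(8/13) * u j = 0"
      by (simp add: u_def)
  qed
  ultimately have "pairing M z (\<lambda>j. (8/13) * u j) \<le> c"
    using bound unfolding flat_tail_bound_def by blast
  then have "pairing M z u \<le> 13/8 * c"
    by (simp only: pairing_scale_right)
  moreover have "pairing M z u \<ge> 9/10 * c + 9/10 * c"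
  proof -
    have *: "9/10 * c \<le> pairing M z (Y i)" if "i \<le> r" for i
      using yy(5)[of "s i"] by (simp add: ext[OF that])
    then have "(\<Sum>i=1..r. 9/10 * c) \<le> (\<Sum>i=1..r. pairing M z (Y i))"
      by (intro sum_mono) auto
    then have "9/10 * c \<le> (1 / real r) * (\<Sum>i=1..r. pairing M z (Y i))"
      using r by (simp add: field_simps)
    with *[OF le0] show ?thesis
      unfolding pairing_u by linarith
  qed
  ultimately show False
    using c by simp
qed

lemma flat_tail_bound_small:
  assumes "norm_le z C" "e > 0"
  obtains q where "flat_tail_bound z q e"
proof -
  define D where "D = C + 1"
  have D: "D > 0"
    using norm_le_nonneg[OF assms(1)] by (simp add: D_def)
  have "\<exists>q. flat_tail_bound z q ((9/10) ^ k * D)" for k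
  proof (induction k)
    case 0
    have "flat_tail_bound z 0 D"
      using assms(1) by (force simp: flat_tail_bound_def norm_le_def D_def)
    then show ?case
      by auto
  next
    case (Suc k)
    then obtain q where "flat_tail_bound z q ((9/10) ^ k * D)"
      by blast
    then have "\<exists>q'. flat_tail_bound z q' (9/10 * ((9/10) ^ k * D))"
      by (rule flat_tail_bound_shrink) (use D in simp)
    then show ?case
      by (simp add: mult.assoc)
  qed
  moreover obtain k where "(9/10) ^ k < e / D"
    using real_arch_pow_inv[of "e / D" "9/10"] assms(2) D by auto
  ultimately obtain q where "flat_tail_bound z q ((9/10) ^ k * D)" "(9/10) ^ k * D < e"
    using D by (auto simp: pos_less_divide_eq)
  then have "flat_tail_bound z q e"
    by (force simp: flat_tail_bound_def)
  then show ?thesis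
    by (rule that)
qed

lemma abs_sum_le_1_if_in_ball:
  assumes "in_ball n y"
  shows "\<bar>\<Sum>i<n. y i\<bar> \<le> 1"
  using norm_le_abs[OF norm_le_const[of 1] assms] by (simp add: pairing_def)

lemma flat_tail_bound_coordinates:
  assumes bound: "flat_tail_bound z q e" and ij: "q \<le> i" "q \<le> j"
  shows "z i - z j \<le> 2 * e"
proof (cases "i = j")
  case True
  have "pairing 0 z (\<lambda>i. 0) \<le> e"
    using bound in_ball_0[of 0] by (force simp: flat_tail_bound_def)
  with True show ?thesis
    by (simp add: pairing_def)
next
  case False
  define n where "n = Suc (max i j)"
  define y where "y l = (1/2) * ((if l = i then 1 else 0) + - (if l = j then 1 else 0 :: real))" for l
  have eq: "pairing n w y = (1/2) * (w i - w j)" for w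
    unfolding y_def pairing_scale_right pairing_add_right pairing_minus_right
    by (simp add: pairing_def n_def if_distrib cong: if_cong)
  have "in_ball n y"
    unfolding in_ball_def eq
  proof (intro allI impI)
    fix \<phi> assume "tree_functional \<phi>"
    then have "\<bar>\<phi> i\<bar> \<le> 1" "\<bar>\<phi> j\<bar> \<le> 1"
      by (rule tree_functional_abs_le_1)+
    then show "(1/2) * (\<phi> i - \<phi> j) \<le> 1"
      by (simp add: abs_le_iff)
  qed
  moreover have "(\<Sum>l<n. y l) = 0"
    using eq[of "\<lambda>l. 1"] by (simp add: pairing_def)
  moreover have "\<forall>l<q. y l = 0"
    using ij by (auto simp: y_def)
  ultimately have "pairing n z y \<le> e"
    using bound by (auto simp: flat_tail_bound_def)
  then show ?thesis
    by (simp add: eq)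
qed

lemma norm_le_imp_LIMSEQ_lim:
  assumes "norm_le z C"
  shows "z \<longlonglongrightarrow> lim z"
proof -
  have "Cauchy z"
  proof (rule metric_CauchyI)
    fix e :: real assume "e > 0"
    then obtain q where q: "flat_tail_bound z q (e/3)"
      using flat_tail_bound_small[OF assms, of "e/3"] by auto
    have "\<bar>z i - z j\<bar> < e" if "q \<le> i" "q \<le> j" for i j
      using flat_tail_bound_coordinates[OF q that] flat_tail_bound_coordinates[OF q that(2,1)] \<open>e > 0\<close>
      by linarith
    then show "\<exists>M. \<forall>m\<ge>M. \<forall>n\<ge>M. dist (z m) (z n) < e"
      by (auto simp: dist_real_def)
  qed
  then show ?thesis
    by (simp add: Cauchy_convergent_iff convergent_LIMSEQ_iff)
qed

lemma abs_lim_le_if_norm_le: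
  assumes "norm_le z C"
  shows "\<bar>lim z\<bar> \<le> C"
proof (rule Lim_bounded)
  show "(\<lambda>i. \<bar>z i\<bar>) \<longlonglongrightarrow> \<bar>lim z\<bar>"
    using norm_le_imp_LIMSEQ_lim[OF assms] by (rule tendsto_rabs)
  show "\<forall>n\<ge>0. \<bar>z n\<bar> \<le> C"
    using norm_le_coordinate[OF assms] by blast
qed

text \<open>
  A vector of the ball becomes flat after subtracting its coordinate sum at a remote
  coordinate.  In the limit, pairing \<open>z\<close> with this correction amounts to subtracting \<open>lim z\<close> from \<open>z\<close>.
\<close>

lemma norm_le_tail_minus_lim:
  assumes "norm_le z C" "e > 0"
  obtains q where "p \<le> q" "norm_le (tail_from q (\<lambda>i. z i - lim z)) e"
proof -
  obtain q0 where q0: "flat_tail_bound z q0 (e/4)"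
    using flat_tail_bound_small[OF assms(1), of "e/4"] assms(2) by auto
  define q where "q = max p q0"
  have q: "flat_tail_bound z q (e/4)"
    using q0 by (auto simp: flat_tail_bound_def q_def)
  have "norm_le (tail_from q (\<lambda>i. z i - lim z)) e"
    unfolding norm_le_def
  proof (intro allI impI)
    fix n y assume y: "in_ball n y"
    have "eventually (\<lambda>m. \<bar>z m - lim z\<bar> < e/2) sequentially"
      using tendstoD[OF norm_le_imp_LIMSEQ_lim[OF assms(1)], of "e/2"] assms(2)
      by (simp add: dist_real_def)
    then obtain m0 where m0: "\<And>m. m0 \<le> m \<Longrightarrow> \<bar>z m - lim z\<bar> < e/2"
      unfolding eventually_sequentially by blast
    define m where "m = max m0 (max n q)"
    have m: "max n q \<le> m" "\<bar>z m - lim z\<bar> < e/2"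
      using m0[of m] by (simp_all add: m_def)
    define x where "x = window q n y"
    have ball: "in_ball n x"
      unfolding x_def using y by (rule in_ball_window)
    define S where "S = (\<Sum>i<n. x i)"
    have S: "\<bar>S\<bar> \<le> 1"
      unfolding S_def using ball by (rule abs_sum_le_1_if_in_ball)
    \<comment> \<open>Balance the coordinate sum of \<open>x\<close> by one coordinate far out, where \<open>z\<close> is close to its limit.
        The factor \<open>1/2\<close> brings the vector back into the ball.\<close>
    define v where "v i = (1/2) * (x i + (- S) * (if i = m then 1 else 0))" for i
    have eq: "pairing (Suc m) w v = (1/2) * (pairing n w x + - S * w m)" for w
    proof -
      have "pairing (Suc m) w x = pairing n w x"
        using m(1) by (intro pairing_extend) (auto simp: x_def window_def)
      then show ?thesis
        unfolding v_def pairing_scale_right pairing_add_right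
        by (simp add: pairing_def if_distrib cong: if_cong)
    qed
    have "in_ball (Suc m) v"
      unfolding in_ball_def eq
    proof (intro allI impI)
      fix \<phi> assume \<phi>: "tree_functional \<phi>"
      have "pairing n \<phi> x \<le> 1"
        using ball \<phi> by (simp add: in_ball_def)
      moreover have "\<bar>S * \<phi> m\<bar> \<le> 1 * 1"
        unfolding abs_mult using S tree_functional_abs_le_1[OF \<phi>, of m] by (intro mult_mono) auto
      ultimately show "(1/2) * (pairing n \<phi> x + - S * \<phi> m) \<le> 1"
        by (simp add: abs_le_iff)
    qed
    moreover have "(\<Sum>i<Suc m. v i) = 0"
      using eq[of "\<lambda>i. 1"] by (simp add: pairing_def S_def)
    moreover have "\<forall>i<q. v i = 0"
      using m(1) by (auto simp: v_def x_def window_def)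
    ultimately have "pairing (Suc m) z v \<le> e/4"
      using q unfolding flat_tail_bound_def by blast
    then have "pairing n z x \<le> e/2 + S * z m"
      by (simp add: eq)
    moreover have "pairing n (tail_from q (\<lambda>i. z i - lim z)) y = pairing n z x - S * lim z"
    proof -
      have "pairing n (tail_from q (\<lambda>i. z i - lim z)) y = (\<Sum>i<n. (z i - lim z) * x i)"
        unfolding pairing_def by (intro sum.cong) (auto simp: tail_from_def x_def window_def)
      then show ?thesis
        by (simp add: pairing_def S_def left_diff_distrib sum_subtractf sum_distrib_left[symmetric])
    qed
    moreover have "S * (z m - lim z) \<le> 1 * (e/2)"
    proof -
      have "S * (z m - lim z) \<le> \<bar>S\<bar> * \<bar>z m - lim z\<bar>"
        by (metis abs_ge_self abs_mult)
      also have "\<dots> \<le> 1 * (e/2)"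
        using S m(2) by (intro mult_mono) auto
      finally show ?thesis .
    qed
    ultimately show "pairing n (tail_from q (\<lambda>i. z i - lim z)) y \<le> e"
      unfolding right_diff_distrib by linarith
  qed
  then show ?thesis
    using that[of q] by (simp add: q_def)
qed


section \<open>The Banach space\<close>

definition tree_norm :: "(nat \<Rightarrow> real) \<Rightarrow> real" where
  "tree_norm z = Inf {C. norm_le z C}"

text \<open>
  The sequences of finite norm form the direct sum of this space and the constants, and the tails of
  the sequences in this space tend to 0 in norm.  A condition on the coordinates rather than on the
  norms of the tails makes it plain that the space is closed.
\<close>

definition tree_space :: "(nat \<Rightarrow> real) set" where
  "tree_space = {z. (\<exists>C. norm_le z C) \<and> z \<longlonglongrightarrow> 0}"

lemma tree_norm_le_iff:
  assumes "norm_le z D"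
  shows "tree_norm z \<le> C \<longleftrightarrow> norm_le z C"
proof
  have "norm_le z (tree_norm z)"
    unfolding norm_le_def[of z "tree_norm z"] unfolding tree_norm_def
  proof (intro allI impI cInf_greatest)
    show "{C. norm_le z C} \<noteq> {}"
      using assms by blast
  qed (auto simp: norm_le_def)
  then show "norm_le z C" if "tree_norm z \<le> C"
    using that by (rule norm_le_mono)
next
  assume "norm_le z C"
  moreover have "bdd_below {C. norm_le z C}"
    using norm_le_nonneg by (intro bdd_belowI[of _ 0]) auto
  ultimately show "tree_norm z \<le> C"
    unfolding tree_norm_def by (intro cInf_lower) auto
qed

lemma norm_le_tree_norm: "norm_le z C \<Longrightarrow> norm_le z (tree_norm z)"
  using tree_norm_le_iff by blast

lemma tree_norm_le: "norm_le z C \<Longrightarrow> tree_norm z \<le> C"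
  using tree_norm_le_iff by blast

lemma norm_le_tree_norm_if_mem: "z \<in> tree_space \<Longrightarrow> norm_le z (tree_norm z)"
  unfolding tree_space_def using norm_le_tree_norm by blast

lemma subspace_tree_space: "subspace tree_space"
proof (rule subspaceI)
  show "0 \<in> tree_space"
    using norm_le_const[of 0] by (auto simp: tree_space_def zero_fun_def)
next
  fix z w assume "z \<in> tree_space" "w \<in> tree_space"
  then show "z + w \<in> tree_space"
    unfolding tree_space_def plus_fun_def using norm_le_add[of z _ w] tendsto_add[of z 0 _ w 0]
    by auto
next
  fix c z assume "z \<in> tree_space"
  then show "c *\<^sub>R z \<in> tree_space"
    unfolding tree_space_def scaleR_fun_def using norm_le_scale[of z _ c] tendsto_mult_right_zero[of z _ c]
    by auto
qed

lemma norm_on_tree_space: "norm_on tree_space tree_norm"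
  unfolding norm_on_def
proof (intro conjI ballI allI)
  fix z assume z: "z \<in> tree_space"
  note nz = norm_le_tree_norm_if_mem[OF z]
  show "0 \<le> tree_norm z"
    using nz by (rule norm_le_nonneg)
  show "tree_norm z = 0 \<longleftrightarrow> z = 0"
  proof
    assume "tree_norm z = 0"
    then show "z = 0"
      using norm_le_coordinate[OF nz] by (auto simp: fun_eq_iff)
  next
    assume z: "z = 0"
    then have "norm_le z 0"
      using norm_le_const[of 0] by (simp add: zero_fun_def)
    then have "tree_norm z \<le> 0"
      by (rule tree_norm_le)
    with \<open>0 \<le> tree_norm z\<close> show "tree_norm z = 0"
      by simp
  qed
  fix c
  have le: "tree_norm (c *\<^sub>R w) \<le> \<bar>c\<bar> * tree_norm w" if "w \<in> tree_space" for c w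
    using tree_norm_le[OF norm_le_scale[OF norm_le_tree_norm_if_mem[OF that], of c]]
    by (simp add: scaleR_fun_def)
  show "tree_norm (c *\<^sub>R z) = \<bar>c\<bar> * tree_norm z"
  proof (cases "c = 0")
    case True
    then show ?thesis
      using le[OF z, of 0] norm_le_nonneg[OF norm_le_tree_norm_if_mem[OF subspace_scale[OF subspace_tree_space z, of c]]]
      by simp
  next
    case False
    have "tree_norm ((1/c) *\<^sub>R (c *\<^sub>R z)) \<le> \<bar>1/c\<bar> * tree_norm (c *\<^sub>R z)"
      by (intro le subspace_scale[OF subspace_tree_space] z)
    then have "\<bar>c\<bar> * tree_norm z \<le> tree_norm (c *\<^sub>R z)"
      using False by (simp add: field_simps)
    with le[OF z, of c] show ?thesis
      by simp
  qed
next
  fix z w assume "z \<in> tree_space" "w \<in> tree_space"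
  then have "norm_le (z + w) (tree_norm z + tree_norm w)"
    unfolding plus_fun_def by (intro norm_le_add norm_le_tree_norm_if_mem)
  then show "tree_norm (z + w) \<le> tree_norm z + tree_norm w"
    by (rule tree_norm_le)
qed

lemma mspace_tree_space [simp]: "mspace (norm_metric tree_space tree_norm) = tree_space"
  by (rule mspace_norm_metric[OF subspace_tree_space norm_on_tree_space])

lemma mdist_tree_space:
  "z \<in> tree_space \<Longrightarrow> w \<in> tree_space \<Longrightarrow>
    mdist (norm_metric tree_space tree_norm) z w = tree_norm (z - w)"
  by (rule mdist_norm_metric[OF subspace_tree_space norm_on_tree_space])

lemma norm_le_if_tree_norm_diff_le:
  assumes "z \<in> tree_space" "w \<in> tree_space" "tree_norm (z - w) \<le> C"
  shows "norm_le (\<lambda>i. z i - w i) C"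
  using norm_le_mono[OF norm_le_tree_norm_if_mem assms(3)] subspace_diff[OF subspace_tree_space assms(1,2)]
  by (simp add: fun_diff_def)

lemma banach_on_tree_space: "banach_on tree_space tree_norm"
  unfolding banach_on_def
proof (intro conjI subspace_tree_space norm_on_tree_space)
  let ?m = "norm_metric tree_space tree_norm"
  interpret Metric_space "mspace ?m" "mdist ?m"
    by (rule Metric_space_mspace_mdist)
  show "mcomplete_of ?m"
    unfolding mcomplete_of_def mcomplete_def
  proof (intro allI impI)
    fix \<sigma> assume \<sigma>: "MCauchy \<sigma>"
    then have "range \<sigma> \<subseteq> mspace ?m"
      unfolding MCauchy_def by blast
    then have mem: "\<sigma> n \<in> tree_space" for n
      by auto
    have close: "\<exists>M. \<forall>m\<ge>M. \<forall>n\<ge>M. norm_le (\<lambda>i. \<sigma> m i - \<sigma> n i) e" if "e > 0" for e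
    proof -
      obtain M where "\<And>m n. m \<ge> M \<Longrightarrow> n \<ge> M \<Longrightarrow> mdist ?m (\<sigma> m) (\<sigma> n) < e"
        using \<sigma> \<open>e > 0\<close> unfolding MCauchy_def by blast
      then show ?thesis
        using norm_le_if_tree_norm_diff_le[OF mem mem, of _ _ e] mem
        by (intro exI[of _ M]) (force simp: mdist_tree_space)
    qed
    have "Cauchy (\<lambda>n. \<sigma> n i)" for i
    proof (rule metric_CauchyI)
      fix e :: real assume "e > 0"
      then obtain M where "\<forall>m\<ge>M. \<forall>n\<ge>M. norm_le (\<lambda>i. \<sigma> m i - \<sigma> n i) (e/2)"
        using close[of "e/2"] by auto
      then have "\<forall>m\<ge>M. \<forall>n\<ge>M. \<bar>\<sigma> m i - \<sigma> n i\<bar> \<le> e/2"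
        using norm_le_coordinate by blast
      then show "\<exists>M. \<forall>m\<ge>M. \<forall>n\<ge>M. dist (\<sigma> m i) (\<sigma> n i) < e"
        using \<open>e > 0\<close> by (intro exI[of _ M]) (force simp: dist_real_def)
    qed
    then have "\<exists>l. (\<lambda>n. \<sigma> n i) \<longlonglongrightarrow> l" for i
      by (simp add: Cauchy_convergent_iff convergent_def)
    then obtain z where z: "\<And>i. (\<lambda>n. \<sigma> n i) \<longlonglongrightarrow> z i"
      by metis
    have limit: "\<exists>M. \<forall>m\<ge>M. norm_le (\<lambda>i. \<sigma> m i - z i) e" if "e > 0" for e
    proof -
      obtain M where M: "\<And>m n. m \<ge> M \<Longrightarrow> n \<ge> M \<Longrightarrow> norm_le (\<lambda>i. \<sigma> m i - \<sigma> n i) e"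
        using close[OF \<open>e > 0\<close>] by blast
      have "norm_le (\<lambda>i. \<sigma> m i - z i) e" if m: "m \<ge> M" for m
      proof (rule norm_le_finite_approx)
        fix q and d :: real assume "d > 0"
        then have "\<forall>\<^sub>F n in sequentially. \<bar>\<sigma> n i - z i\<bar> < d" for i
          using tendstoD[OF z] by (simp add: dist_real_def)
        then have "\<forall>\<^sub>F n in sequentially. \<forall>i\<in>{..<q}. \<bar>\<sigma> n i - z i\<bar> < d"
          by (intro eventually_ball_finite) auto
        then have "\<forall>\<^sub>F n in sequentially. n \<ge> M \<and> (\<forall>i\<in>{..<q}. \<bar>\<sigma> n i - z i\<bar> < d)"
          using eventually_ge_at_top[of M] by eventually_elim blast
        then obtain n where n: "n \<ge> M" "\<forall>i\<in>{..<q}. \<bar>\<sigma> n i - z i\<bar> < d"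
          using eventually_happens'[OF sequentially_bot] by blast
        then show "\<exists>w. norm_le w e \<and> (\<forall>i<q. \<bar>\<sigma> m i - z i - w i\<bar> < d)"
          using M[OF m n(1)] by (intro exI[of _ "\<lambda>i. \<sigma> m i - \<sigma> n i"]) auto
      qed
      then show ?thesis
        by blast
    qed
    have "z \<in> tree_space"
    proof -
      obtain M where "norm_le (\<lambda>i. \<sigma> M i - z i) 1"
        using limit[of 1] by auto
      from norm_le_diff[OF norm_le_tree_norm_if_mem[OF mem[of M]] this]
      have bound: "\<exists>C. norm_le z C"
        by auto
      have "z \<longlonglongrightarrow> 0"
      proof (rule LIMSEQ_I)
        fix e :: real assume "e > 0"
        then obtain M where M: "norm_le (\<lambda>i. \<sigma> M i - z i) (e/2)"
          using limit[of "e/2"] by auto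
        have "\<sigma> M \<longlonglongrightarrow> 0"
          using mem by (simp add: tree_space_def)
        then obtain i0 where "\<forall>i\<ge>i0. \<bar>\<sigma> M i\<bar> < e/2"
          using LIMSEQ_D[of "\<sigma> M" 0 "e/2"] \<open>e > 0\<close> by auto
        moreover have "\<bar>z i\<bar> \<le> \<bar>\<sigma> M i\<bar> + e/2" for i
          using norm_le_coordinate[OF M, of i] by linarith
        ultimately show "\<exists>i0. \<forall>i\<ge>i0. norm (z i - 0) < e"
          by (intro exI[of _ i0]) (smt (verit) diff_zero field_sum_of_halves real_norm_def)
      qed
      with bound show ?thesis
        by (simp add: tree_space_def)
    qed
    moreover have "\<forall>\<^sub>F n in sequentially. mdist ?m (\<sigma> n) z < e" if "e > 0" for e
    proof -
      obtain M where M: "\<And>m. m \<ge> M \<Longrightarrow> norm_le (\<lambda>i. \<sigma> m i - z i) (e/2)"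
        using limit[OF half_gt_zero[OF \<open>e > 0\<close>]] by blast
      have "mdist ?m (\<sigma> m) z < e" if "m \<ge> M" for m
      proof -
        have "tree_norm (\<sigma> m - z) \<le> e/2"
          unfolding fun_diff_def using M[OF that] by (rule tree_norm_le)
        then show ?thesis
          using \<open>e > 0\<close> by (simp add: mdist_tree_space mem \<open>z \<in> tree_space\<close>)
      qed
      then show ?thesis
        unfolding eventually_sequentially by blast
    qed
    ultimately have "limitin mtopology \<sigma> z sequentially"
      unfolding limitin_metric using mem by simp
    then show "\<exists>z. limitin mtopology \<sigma> z sequentially"
      by blast
  qed
qed


section \<open>The space is not reflexive\<close>

lemma tree_space_window:
  "window a b (\<lambda>i. c) \<in> tree_space"
proof -
  have "\<forall>\<^sub>F i in sequentially. window a b (\<lambda>i. c) i = 0"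
    using eventually_ge_at_top[of b] by eventually_elim (simp add: window_def)
  then have "window a b (\<lambda>i. c) \<longlonglongrightarrow> 0"
    by (rule tendsto_eventually)
  moreover have "norm_le (window a b (\<lambda>i. c)) \<bar>c\<bar>"
    by (intro norm_le_window norm_le_const)
  ultimately show ?thesis
    by (auto simp: tree_space_def)
qed

text \<open>
  If the values of \<open>F\<close> on the initial windows changed by \<open>e\<close> infinitely often, \<open>r\<close> successive windows
  starting after \<open>r\<close>, with suitable signs, would add up to a sequence of norm at most 2 on which
  \<open>F\<close> is at least \<open>r * e\<close>.
\<close>

lemma functional_on_initial_windows_convergent:
  assumes F: "F \<in> dual_space tree_space tree_norm"
  shows "convergent (\<lambda>n. F (window 0 n (\<lambda>i. 1)))"
proof -
  have add: "F (z + w) = F z + F w" if "z \<in> tree_space" "w \<in> tree_space" for z w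
    using F that by (simp add: dual_space_def)
  have scale: "F (c *\<^sub>R z) = c * F z" if "z \<in> tree_space" for c z
    using F that by (simp add: dual_space_def)
  obtain B0 where B0: "\<And>z. z \<in> tree_space \<Longrightarrow> \<bar>F z\<bar> \<le> B0 * tree_norm z"
    using F unfolding dual_space_def by blast
  define B where "B = \<bar>B0\<bar>"
  have B: "\<bar>F z\<bar> \<le> B * C" if "z \<in> tree_space" "norm_le z C" for z C
  proof -
    have "\<bar>F z\<bar> \<le> B * tree_norm z"
      using B0[OF that(1)] norm_le_nonneg[OF norm_le_tree_norm_if_mem[OF that(1)]]
        mult_right_mono[of B0 B "tree_norm z"] abs_ge_self[of B0] unfolding B_def by linarith
    also have "\<dots> \<le> B * C"
      using tree_norm_le[OF that(2)] by (intro mult_left_mono) (auto simp: B_def)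
    finally show ?thesis .
  qed
  define s where "s n = F (window 0 n (\<lambda>i. 1))" for n
  have diff: "F (window a b (\<lambda>i. c)) = c * (s b - s a)" if "a \<le> b" for a b c
  proof -
    have "window 0 b (\<lambda>i. 1) = window 0 a (\<lambda>i. 1) + window a b (\<lambda>i. 1)"
      using that by (auto simp: window_def fun_eq_iff)
    then have "s b = s a + F (window a b (\<lambda>i. 1))"
      unfolding s_def by (simp add: add tree_space_window)
    moreover have "window a b (\<lambda>i. c) = c *\<^sub>R window a b (\<lambda>i. 1)"
      by (auto simp: window_def fun_eq_iff)
    ultimately show ?thesis
      by (simp add: scale tree_space_window)
  qed
  have "Cauchy s"
    unfolding Cauchy_altdef2
  proof (rule ccontr)
    assume "\<not> (\<forall>e>0. \<exists>N. \<forall>n\<ge>N. dist (s n) (s N) < e)"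
    then obtain e where e: "e > 0" "\<forall>N. \<exists>n\<ge>N. \<bar>s n - s N\<bar> \<ge> e"
      by (auto simp: dist_real_def not_less)
    then obtain g where g: "\<And>N. N \<le> g N" "\<And>N. e \<le> \<bar>s (g N) - s N\<bar>"
      by metis
    obtain r :: nat where r: "real r > 2 * B / e"
      using reals_Archimedean2 by blast
    define t where "t i = (g ^^ i) r" for i
    have t: "mono t" "t 0 = r" "\<And>i. t (Suc i) = g (t i)"
      by (simp_all add: t_def mono_iff_le_Suc g(1))
    define c where "c i = (if s (t (Suc i)) - s (t i) \<ge> 0 then 1 else -1 :: real)" for i
    define z where "z m = (\<lambda>j. \<Sum>i<m. window (t i) (t (Suc i)) (\<lambda>j. c i) j)" for m
    have z_Suc: "z (Suc m) = z m + window (t m) (t (Suc m)) (\<lambda>j. c m)" for m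
      by (simp add: z_def fun_eq_iff)
    have z_mem: "z m \<in> tree_space" for m
    proof (induction m)
      case 0
      then show ?case
        using subspace_0[OF subspace_tree_space] by (simp add: z_def zero_fun_def)
    next
      case (Suc m)
      then show ?case
        unfolding z_Suc by (intro subspace_add[OF subspace_tree_space] tree_space_window)
    qed
    have F_z: "real m * e \<le> F (z m)" for m
    proof (induction m)
      case 0
      have "F 0 = 0"
        using scale[OF z_mem[of 0], of 0] by simp
      moreover have "z 0 = 0"
        by (simp add: z_def fun_eq_iff)
      ultimately show ?case
        by (simp only: of_nat_0 mult_zero_left)
    next
      case (Suc m)
      have "F (z (Suc m)) = F (z m) + c m * (s (t (Suc m)) - s (t m))"
        unfolding z_Suc using g(1)[of "t m"] by (simp add: add z_mem tree_space_window diff t(3))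
      also have "c m * (s (t (Suc m)) - s (t m)) = \<bar>s (t (Suc m)) - s (t m)\<bar>"
        by (simp add: c_def)
      finally show ?case
        using Suc g(2)[of "t m"] by (simp add: t(3) algebra_simps)
    qed
    have piece: "window (t l) (t (Suc l)) (z r) = window (t l) (t (Suc l)) (\<lambda>j. c l)" if "l < r" for l
      using sum_windows_eq[OF t(1) that, of _ "\<lambda>i j. c i"] by (force simp: window_def z_def)
    have "norm_le (window (t 0) (t r) (z r)) (2 * 1)"
    proof (rule norm_le_successive_pieces)
      fix l assume "l < r"
      have "\<bar>c l\<bar> \<le> 1"
        by (simp add: c_def)
      then show "norm_le (window (t l) (t (Suc l)) (z r)) 1"
        unfolding piece[OF \<open>l < r\<close>] by (intro norm_le_window norm_le_mono[OF norm_le_const])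
    qed (use t in auto)
    moreover have "window (t 0) (t r) (z r) = z r"
    proof
      fix j
      have "window (t 0) (t r) (z r) j = (\<Sum>l<r. window (t l) (t (Suc l)) (z r) j)"
        by (rule window_eq_sum_windows[OF t(1)])
      also have "\<dots> = (\<Sum>l<r. window (t l) (t (Suc l)) (\<lambda>j. c l) j)"
        by (intro sum.cong) (simp_all add: piece)
      also have "\<dots> = z r j"
        by (simp add: z_def)
      finally show "window (t 0) (t r) (z r) j = z r j" .
    qed
    ultimately have "\<bar>F (z r)\<bar> \<le> B * 2"
      using B[OF z_mem, of r 2] by simp
    moreover have "real r * e > 2 * B"
      using r e(1) by (simp add: field_simps)
    ultimately show False
      using F_z[of r] by linarith
  qed
  then show ?thesis
    by (simp add: Cauchy_convergent_iff s_def[abs_def])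
qed

text \<open>
  The limit along the initial windows is an element of the bidual.  Tested on the coordinate functionals,
  it would have to be represented by the constant sequence 1, which does not tend to 0.
\<close>

lemma not_reflexive_on_tree_space: "\<not> reflexive_on tree_space tree_norm"
proof
  let ?D = "dual_space tree_space tree_norm"
  assume "reflexive_on tree_space tree_norm"
  then have refl: "canonical_embedding tree_space tree_norm ` tree_space = dual_space ?D (dual_norm tree_space tree_norm)"
    by (simp add: reflexive_on_def)
  define e where "e n = window 0 n (\<lambda>i. 1)" for n
  have e_mem: "e n \<in> tree_space" for n
    unfolding e_def by (rule tree_space_window)
  have e_norm: "tree_norm (e n) \<le> 1" for n
    unfolding e_def by (intro tree_norm_le norm_le_tree_functional segment) simp
  define G where "G F = (if F \<in> ?D then lim (\<lambda>n. F (e n)) else 0)" for F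
  have lim_G: "(\<lambda>n. F (e n)) \<longlonglongrightarrow> G F" if "F \<in> ?D" for F
    using functional_on_initial_windows_convergent[OF that] that
    by (simp add: G_def e_def convergent_LIMSEQ_iff)
  have "G \<in> dual_space ?D (dual_norm tree_space tree_norm)"
    unfolding dual_space_def[of ?D]
  proof (intro CollectI conjI ballI allI exI impI)
    fix F H assume FH: "F \<in> ?D" "H \<in> ?D"
    then have "(\<lambda>n. (F + H) (e n)) \<longlonglongrightarrow> G F + G H"
      using tendsto_add[OF lim_G lim_G] by simp
    moreover have "(\<lambda>n. (F + H) (e n)) \<longlonglongrightarrow> G (F + H)"
      by (intro lim_G subspace_add[OF subspace_dual_space] FH)
    ultimately show "G (F + H) = G F + G H"
      using LIMSEQ_unique by blast
  next
    fix c F assume F: "F \<in> ?D"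
    then have "(\<lambda>n. (c *\<^sub>R F) (e n)) \<longlonglongrightarrow> c * G F"
      using tendsto_mult_left[OF lim_G] by simp
    moreover have "(\<lambda>n. (c *\<^sub>R F) (e n)) \<longlonglongrightarrow> G (c *\<^sub>R F)"
      by (intro lim_G subspace_scale[OF subspace_dual_space] F)
    ultimately show "G (c *\<^sub>R F) = c * G F"
      using LIMSEQ_unique by blast
  next
    fix F assume F: "F \<in> ?D"
    have "\<bar>F (e n)\<bar> \<le> dual_norm tree_space tree_norm F" for n
    proof -
      have bound: "\<bar>F z\<bar> \<le> dual_norm tree_space tree_norm F * tree_norm z" if "z \<in> tree_space" for z
        by (intro dual_norm_bound subspace_tree_space norm_on_tree_space F that)
      have "\<bar>F (e 1)\<bar> \<le> dual_norm tree_space tree_norm F * tree_norm (e 1)"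
        by (intro bound e_mem)
      moreover have "0 < tree_norm (e 1)"
        using norm_le_coordinate[OF norm_le_tree_norm_if_mem[OF e_mem[of 1]], of 0]
        by (simp add: e_def window_def)
      ultimately have "0 \<le> dual_norm tree_space tree_norm F"
        by (metis abs_ge_zero order_trans zero_le_mult_iff not_le)
      then have "dual_norm tree_space tree_norm F * tree_norm (e n) \<le> dual_norm tree_space tree_norm F * 1"
        using e_norm by (intro mult_left_mono)
      then show ?thesis
        using bound[OF e_mem[of n]] by simp
    qed
    then show "\<bar>G F\<bar> \<le> 1 * dual_norm tree_space tree_norm F"
      using lim_G[OF F] by (intro Lim_bounded[OF tendsto_rabs]) auto
  qed (simp add: G_def)
  then obtain z where z: "z \<in> tree_space" "canonical_embedding tree_space tree_norm z = G"
    using refl by (metis imageE)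
  have "z j = 1" for j
  proof -
    define F where "F = (\<lambda>w. if w \<in> tree_space then w j else 0 :: real)"
    have "\<bar>F w\<bar> \<le> 1 * tree_norm w" if "w \<in> tree_space" for w
      using norm_le_coordinate[OF norm_le_tree_norm_if_mem[OF that]] that by (simp add: F_def)
    then have F: "F \<in> ?D"
      unfolding dual_space_def
      by (auto simp: F_def subspace_add[OF subspace_tree_space] subspace_scale[OF subspace_tree_space]
        intro!: exI[of _ 1])
    have "\<forall>\<^sub>F n in sequentially. F (e n) = 1"
      using eventually_gt_at_top[of j] by eventually_elim (simp add: F_def e_mem, simp add: e_def window_def)
    then have "(\<lambda>n. F (e n)) \<longlonglongrightarrow> 1"
      by (rule tendsto_eventually)
    then have "G F = 1"
      using lim_G[OF F] LIMSEQ_unique by blast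
    moreover have "G F = F z"
      using z(2)[symmetric] F by (simp add: canonical_embedding_def)
    ultimately show ?thesis
      using z(1) by (simp add: F_def)
  qed
  then have "z = (\<lambda>j. 1)"
    by blast
  then have "(\<lambda>j. 1 :: real) \<longlonglongrightarrow> 0"
    using z(1) by (simp add: tree_space_def)
  then show False
    using LIMSEQ_unique[OF tendsto_const] by fastforce
qed


section \<open>Iterated generalized limits\<close>

text \<open>
  A generalized limit is a cluster point of finitely many bounded sequences simultaneously, as is a limit
  along a free ultrafilter.  It thus lets one index \<open>n\<close> serve finitely many purposes.
\<close>

definition generalized_limit :: "((nat \<Rightarrow> real) \<Rightarrow> real) \<Rightarrow> bool" where
  "generalized_limit \<Lambda> \<longleftrightarrow> (\<forall>G e N. finite G \<longrightarrow> (\<forall>g\<in>G. \<exists>B. \<forall>n. \<bar>g n\<bar> \<le> B) \<longrightarrow> e > 0 \<longrightarrow>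
     (\<exists>n\<ge>N. \<forall>g\<in>G. \<bar>g n - \<Lambda> g\<bar> < e))"

text \<open>
  Evaluation at \<open>n\<close> is a point of a product of compact intervals indexed by the bounded sequences.
  Any cluster point of these evaluations, as \<open>n\<close> tends to infinity, is a generalized limit.
\<close>

lemma generalized_limit_exists: "\<exists>\<Lambda>. generalized_limit \<Lambda>"
proof -
  define bd where "bd g \<longleftrightarrow> (\<exists>B. \<forall>n. \<bar>g n\<bar> \<le> B)" for g :: "nat \<Rightarrow> real"
  have "\<forall>g. \<exists>B. bd g \<longrightarrow> (\<forall>n. \<bar>g n\<bar> \<le> B)"
    by (auto simp: bd_def)
  then obtain B where B: "\<And>g n. bd g \<Longrightarrow> \<bar>g n\<bar> \<le> B g"
    by metis
  define ev where "ev n g = (if bd g then g n else 0)" for n g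
  define K where "K = PiE UNIV (\<lambda>g. {- \<bar>B g\<bar>..\<bar>B g\<bar>})"
  have "compactin (product_topology (\<lambda>i. euclidean) UNIV) K"
    unfolding K_def compactin_PiE by simp
  then have "compact K"
    by (simp add: euclidean_product_topology)
  moreover have ev_K: "ev n \<in> K" for n
  proof -
    have "\<bar>ev n g\<bar> \<le> \<bar>B g\<bar>" for g
      using B[of g n] by (cases "bd g") (simp_all add: ev_def)
    then show ?thesis
      by (auto simp: K_def PiE_iff abs_le_iff minus_le_iff)
  qed
  define F where "F = filtermap ev sequentially"
  have "F \<noteq> bot"
    by (simp add: F_def filtermap_bot_iff)
  moreover have "eventually (\<lambda>h. h \<in> K) F"
    by (simp add: F_def eventually_filtermap ev_K)
  ultimately obtain \<Lambda> where \<Lambda>: "inf (nhds \<Lambda>) F \<noteq> bot"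
    using compact_filter[THEN iffD1, rule_format, of K F] by blast
  have "generalized_limit \<Lambda>"
    unfolding generalized_limit_def
  proof (intro allI impI)
    fix G :: "(nat \<Rightarrow> real) set" and e :: real and N :: nat
    assume G: "finite G" "\<forall>g\<in>G. \<exists>B. \<forall>n. \<bar>g n\<bar> \<le> B" and e: "e > 0"
    show "\<exists>n\<ge>N. \<forall>g\<in>G. \<bar>g n - \<Lambda> g\<bar> < e"
    proof (rule ccontr)
      assume neg: "\<not> ?thesis"
      have "\<forall>\<^sub>F h in nhds \<Lambda>. \<bar>h g - \<Lambda> g\<bar> < e" for g
      proof -
        have "open {h :: (nat \<Rightarrow> real) \<Rightarrow> real. \<bar>h g - \<Lambda> g\<bar> < e}"
          by (intro open_Collect_less continuous_intros continuous_on_product_coordinates)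
        then show ?thesis
          using eventually_nhds_in_open[of "{h. \<bar>h g - \<Lambda> g\<bar> < e}" \<Lambda>] e by simp
      qed
      then have "\<forall>\<^sub>F h in nhds \<Lambda>. \<forall>g\<in>G. \<bar>h g - \<Lambda> g\<bar> < e"
        by (intro eventually_ball_finite G) auto
      moreover have "\<forall>\<^sub>F h in F. \<not> (\<forall>g\<in>G. \<bar>h g - \<Lambda> g\<bar> < e)"
        unfolding F_def eventually_filtermap eventually_sequentially
      proof (intro exI[of _ N] allI impI notI)
        fix n assume n: "N \<le> n" "\<forall>g\<in>G. \<bar>ev n g - \<Lambda> g\<bar> < e"
        have "ev n g = g n" if "g \<in> G" for g
          using G(2) that by (simp add: ev_def bd_def)
        then show False
          using n neg by auto
      qed
      ultimately have "eventually (\<lambda>h. False) (inf (nhds \<Lambda>) F)"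
        unfolding eventually_inf by blast
      with \<Lambda> show False
        by (simp add: eventually_False)
    qed
  qed
  then show ?thesis
    by blast
qed

lemma generalized_limit_approx:
  assumes "generalized_limit \<Lambda>" "finite I" "\<And>i n. i \<in> I \<Longrightarrow> \<bar>g i n\<bar> \<le> B" "e > 0"
  obtains n where "N \<le> n" "\<And>i. i \<in> I \<Longrightarrow> \<bar>g i n - \<Lambda> (g i)\<bar> < e"
proof -
  have "\<exists>n\<ge>N. \<forall>h\<in>g ` I. \<bar>h n - \<Lambda> h\<bar> < e"
  proof (rule assms(1)[unfolded generalized_limit_def, rule_format])
    show "\<exists>B. \<forall>n. \<bar>h n\<bar> \<le> B" if "h \<in> g ` I" for h
      using assms(3) that by blast
  qed (use assms in auto)
  then obtain n where "N \<le> n" "\<forall>h\<in>g ` I. \<bar>h n - \<Lambda> h\<bar> < e"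
    by blast
  then show ?thesis
    by (intro that[of n]) auto
qed

lemma abs_generalized_limit_le:
  assumes "generalized_limit \<Lambda>" "\<And>n. \<bar>g n\<bar> \<le> B"
  shows "\<bar>\<Lambda> g\<bar> \<le> B"
proof (rule field_le_epsilon)
  fix e :: real assume "e > 0"
  then obtain n where "\<bar>g n - \<Lambda> g\<bar> < e"
    using generalized_limit_approx[of \<Lambda> "{()}" "\<lambda>_. g" B e] assms by blast
  then show "\<bar>\<Lambda> g\<bar> \<le> B + e"
    using assms(2)[of n] by linarith
qed

primrec iterated_limit ::
    "((nat \<Rightarrow> real) \<Rightarrow> real) \<Rightarrow> nat \<Rightarrow> (nat list \<Rightarrow> real) \<Rightarrow> nat list \<Rightarrow> real" where
  "iterated_limit \<Lambda> 0 g xs = g xs"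
| "iterated_limit \<Lambda> (Suc d) g xs = \<Lambda> (\<lambda>n. iterated_limit \<Lambda> d g (xs @ [n]))"

lemma abs_iterated_limit_le:
  assumes "generalized_limit \<Lambda>" "\<And>ys. \<bar>g ys\<bar> \<le> B"
  shows "\<bar>iterated_limit \<Lambda> d g xs\<bar> \<le> B"
  by (induction d arbitrary: xs) (use assms abs_generalized_limit_le in auto)


section \<open>Lipschitz maps on Hamming graphs concentrate\<close>

text \<open>
  In the window from \<open>q l\<close> to \<open>q (Suc l)\<close> the sequence \<open>w l\<close> is already close to the constant \<open>c l\<close>,
  step \<open>l\<close> adds at most \<open>L\<close>, and later steps are negligible.  So each of the \<open>r\<close> windows of
  \<open>w r\<close> has norm at most \<open>L + K\<close> up to multiples of \<open>e\<close>, and the upper estimate applies because the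
  windows start after \<open>r\<close>.
\<close>

lemma norm_le_chain:
  assumes r: "0 < r" and zero: "\<And>j. w 0 j = 0"
    and step: "\<And>i. i < r \<Longrightarrow> norm_le (\<lambda>j. w (Suc i) j - w i j) L"
    and small: "\<And>i. i < r \<Longrightarrow> norm_le (window 0 (q i) (\<lambda>j. w (Suc i) j - w i j)) e"
    and tail: "\<And>i. i \<le> r \<Longrightarrow> norm_le (tail_from (q i) (\<lambda>j. w i j - c i)) e"
    and c: "\<And>i. i < r \<Longrightarrow> \<bar>c i\<bar> \<le> K" "c r = 0"
    and q: "\<And>i. i < r \<Longrightarrow> q i \<le> q (Suc i)" "r \<le> q 0"
  shows "norm_le (w r) (r * e + 2 * (r * e + L + e + K) + e)"
proof -
  have e: "e \<ge> 0"
    using tail[of 0] norm_le_nonneg by blast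
  define t where "t i = q (min i r)" for i
  have mono: "mono t"
    unfolding mono_iff_le_Suc
  proof
    fix i
    show "t i \<le> t (Suc i)"
      by (cases "i < r") (auto simp: t_def min_def q(1))
  qed
  have q_le: "q i \<le> q m" if "i \<le> m" "m \<le> r" for i m
    using monoD[OF mono that(1)] that by (simp add: t_def)
  have drift: "norm_le (window 0 (q i) (\<lambda>j. w m j - w i j)) (real (m - i) * e)" if "i \<le> m" "m \<le> r" for i m
    using that
  proof (induction m rule: dec_induct)
    case base
    have "window 0 (q i) (\<lambda>j. w i j - w i j) = (\<lambda>j. 0)"
      by (auto simp: window_def)
    then show ?case
      using norm_le_const[of 0] by simp
  next
    case (step m)
    have "norm_le (\<lambda>j. window 0 (q i) (\<lambda>j. w m j - w i j) j +
        window 0 (q i) (window 0 (q m) (\<lambda>j. w (Suc m) j - w m j)) j) (real (m - i) * e + e)"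
      using step by (intro norm_le_add norm_le_window[OF small]) auto
    moreover have "(\<lambda>j. window 0 (q i) (\<lambda>j. w m j - w i j) j +
        window 0 (q i) (window 0 (q m) (\<lambda>j. w (Suc m) j - w m j)) j) =
        window 0 (q i) (\<lambda>j. w (Suc m) j - w i j)"
      using q_le[of i m] step by (auto simp: window_def fun_eq_iff)
    moreover have "real (m - i) * e + e = real (Suc m - i) * e"
      using step by (simp add: Suc_diff_le algebra_simps)
    ultimately show ?case
      by simp
  qed
  have start: "norm_le (window 0 (q 0) (w r)) (r * e)"
    using drift[of 0 r] by (simp add: zero)
  have piece: "norm_le (window (t l) (t (Suc l)) (w r)) (r * e + L + e + K)" if l: "l < r" for l
  proof -
    define a b where "a = q l" and "b = q (Suc l)"
    have "norm_le (\<lambda>j. window a b (window 0 b (\<lambda>j. w r j - w (Suc l) j)) j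
        + window a b (\<lambda>j. w (Suc l) j - w l j) j
        + window a b (tail_from a (\<lambda>j. w l j - c l)) j
        + window a b (\<lambda>j. c l) j) (real (r - Suc l) * e + L + e + K)"
      unfolding a_def b_def using l
      by (intro norm_le_add norm_le_window drift step tail norm_le_mono[OF norm_le_const c(1)]) auto
    moreover have "(\<lambda>j. window a b (window 0 b (\<lambda>j. w r j - w (Suc l) j)) j
        + window a b (\<lambda>j. w (Suc l) j - w l j) j
        + window a b (tail_from a (\<lambda>j. w l j - c l)) j
        + window a b (\<lambda>j. c l) j) = window a b (w r)"
      by (auto simp: window_def tail_from_def fun_eq_iff)
    moreover have "real (r - Suc l) * e \<le> r * e"
      using e by (intro mult_right_mono) auto
    moreover have "t l = a" "t (Suc l) = b"
      using l by (simp_all add: t_def a_def b_def min_def)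
    ultimately show ?thesis
      by (auto elim: norm_le_mono)
  qed
  have "norm_le (window (t 0) (t r) (w r)) (2 * (r * e + L + e + K))"
  proof (rule norm_le_successive_pieces[OF mono _ piece])
    show "r \<le> t 0"
      using q(2) by (simp add: t_def)
    show "0 \<le> r * e + L + e + K"
      using piece[OF r] by (rule norm_le_nonneg)
  qed
  then have "norm_le (\<lambda>j. window 0 (q 0) (w r) j + window (q 0) (q r) (w r) j +
      tail_from (q r) (\<lambda>j. w r j - c r) j) (r * e + 2 * (r * e + L + e + K) + e)"
    by (intro norm_le_add start tail) (auto simp: t_def)
  moreover have "(\<lambda>j. window 0 (q 0) (w r) j + window (q 0) (q r) (w r) j +
      tail_from (q r) (\<lambda>j. w r j - c r) j) = w r"
    using q_le[of 0 r] by (auto simp: window_def tail_from_def c(2) fun_eq_iff)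
  ultimately show ?thesis
    by simp
qed

lemma sorted_wrt_append_gt:
  fixes xs :: "nat list"
  assumes "sorted_wrt (<) xs" "sum_list xs < n"
  shows "sorted_wrt (<) (xs @ [n])"
proof -
  have "x < n" if "x \<in> set xs" for x
    using member_le_sum_list[OF that] assms(2) by linarith
  then show ?thesis
    using assms(1) by (simp add: sorted_wrt_append)
qed

locale hamming_lipschitz =
  fixes \<Lambda> :: "(nat \<Rightarrow> real) \<Rightarrow> real" and k :: nat and f :: "nat set \<Rightarrow> nat \<Rightarrow> real" and R L :: real
  assumes \<Lambda>: "generalized_limit \<Lambda>"
    and f_mem: "\<And>m. finite m \<Longrightarrow> card m = k \<Longrightarrow> f m \<in> tree_space"
    and f_bounded: "\<And>m. finite m \<Longrightarrow> card m = k \<Longrightarrow> norm_le (f m) R"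
    and f_lipschitz: "\<And>m n. \<lbrakk>finite m; card m = k; finite n; card n = k; hamming_dist k m n \<le> 1\<rbrakk> \<Longrightarrow>
      norm_le (\<lambda>i. f m i - f n i) L"
begin

text \<open>
  The value 0 on other lists keeps all sequences occurring in the generalized limits bounded.
\<close>

definition on_list :: "nat list \<Rightarrow> nat \<Rightarrow> real" where
  "on_list xs = (if sorted_wrt (<) xs \<and> length xs = k then f (set xs) else (\<lambda>i. 0))"

text \<open>
  The coordinatewise iterated limit of \<open>f\<close> over all missing elements of \<open>xs\<close>.  Its values have finite norm
  but need not tend to 0.
\<close>

definition partial_limit :: "nat list \<Rightarrow> nat \<Rightarrow> real" where
  "partial_limit xs i = iterated_limit \<Lambda> (k - length xs) (\<lambda>ys. on_list ys i) xs"

text \<open>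
  The constant at infinity of \<open>partial_limit\<close> on lists of length \<open>j\<close>, followed by the iterated limit over the
  elements that \<open>xs\<close> lacks.  For \<open>j > length xs\<close> this may differ from \<open>lim (partial_limit xs)\<close>, where the
  limits are taken in the other order.
\<close>

definition limit_value :: "nat \<Rightarrow> nat list \<Rightarrow> real" where
  "limit_value j xs = iterated_limit \<Lambda> (j - length xs) (\<lambda>ys. lim (partial_limit ys)) xs"

lemma R_nonneg: "R \<ge> 0"
  using f_bounded[of "{..<k}"] by (auto dest: norm_le_nonneg)

lemma L_nonneg: "L \<ge> 0"
  using f_lipschitz[of "{..<k}" "{..<k}"] by (auto dest: norm_le_nonneg simp: hamming_dist_def)

lemma norm_le_on_list: "norm_le (on_list xs) R"
proof (cases "sorted_wrt (<) xs \<and> length xs = k")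
  case True
  then show ?thesis
    using f_bounded[of "set xs"] by (simp add: on_list_def strict_sorted_iff distinct_card)
next
  case False
  then show ?thesis
    using norm_le_mono[OF norm_le_const[of 0]] R_nonneg by (auto simp: on_list_def)
qed

lemma partial_limit_full: "k \<le> length xs \<Longrightarrow> partial_limit xs = on_list xs"
  by (simp add: partial_limit_def fun_eq_iff)

lemma partial_limit_step:
  assumes "length xs < k"
  shows "partial_limit xs i = \<Lambda> (\<lambda>n. partial_limit (xs @ [n]) i)"
  unfolding partial_limit_def Suc_diff_Suc[OF assms, symmetric] by simp

lemma limit_value_full: "limit_value (length xs) xs = lim (partial_limit xs)"
  by (simp add: limit_value_def)

lemma limit_value_step:
  assumes "length xs < j"
  shows "limit_value j xs = \<Lambda> (\<lambda>n. limit_value j (xs @ [n]))"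
  unfolding limit_value_def Suc_diff_Suc[OF assms, symmetric] by simp

lemma abs_partial_limit_le: "\<bar>partial_limit xs i\<bar> \<le> R"
  unfolding partial_limit_def by (intro abs_iterated_limit_le \<Lambda> norm_le_coordinate norm_le_on_list)

lemma norm_le_partial_limit: "norm_le (partial_limit xs) R"
proof (induction "k - length xs" arbitrary: xs)
  case 0
  then show ?case
    using norm_le_on_list by (simp add: partial_limit_full)
next
  case (Suc d)
  show ?case
  proof (rule norm_le_finite_approx)
    fix q and e :: real assume "e > 0"
    then obtain n where n: "\<And>i. i \<in> {..<q} \<Longrightarrow>
        \<bar>partial_limit (xs @ [n]) i - \<Lambda> (\<lambda>n. partial_limit (xs @ [n]) i)\<bar> < e"
      using generalized_limit_approx[OF \<Lambda>, of "{..<q}" "\<lambda>i n. partial_limit (xs @ [n]) i" R e 0]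
        abs_partial_limit_le by auto
    moreover have "norm_le (partial_limit (xs @ [n])) R"
      using Suc(2) by (intro Suc(1)) simp
    ultimately show "\<exists>w. norm_le w R \<and> (\<forall>i<q. \<bar>partial_limit xs i - w i\<bar> < e)"
      using Suc(2) by (intro exI[of _ "partial_limit (xs @ [n])"])
        (auto simp: partial_limit_step abs_minus_commute)
  qed
qed

lemma abs_limit_value_le: "\<bar>limit_value j xs\<bar> \<le> R"
  unfolding limit_value_def by (intro abs_iterated_limit_le \<Lambda> abs_lim_le_if_norm_le norm_le_partial_limit)

text \<open>
  Appending the same large element to both lists preserves the number of differing positions, so the
  Lipschitz bound passes to the limit.
\<close>

lemma norm_le_partial_limit_diff:
  assumes "length xs = length ys" "length xs \<le> k" "sorted_wrt (<) xs" "sorted_wrt (<) ys"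
    "card {i. i < length xs \<and> xs ! i \<noteq> ys ! i} \<le> 1"
  shows "norm_le (\<lambda>i. partial_limit xs i - partial_limit ys i) L"
  using assms
proof (induction "k - length xs" arbitrary: xs ys)
  case 0
  then have len: "length xs = k" "length ys = k"
    by auto
  have "sorted_list_of_set (set xs) = xs" "sorted_list_of_set (set ys) = ys"
    using 0 by (simp_all add: strict_sorted_iff sorted_list_of_set.idem_if_sorted_distinct)
  then have "hamming_dist k (set xs) (set ys) \<le> 1"
    using 0 len by (simp add: hamming_dist_def)
  moreover have "card (set xs) = k" "card (set ys) = k"
    using 0 len by (simp_all add: strict_sorted_iff distinct_card)
  ultimately show ?case
    using f_lipschitz[of "set xs" "set ys"] 0 len by (simp add: partial_limit_full on_list_def)
next
  case (Suc d)
  show ?case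
  proof (rule norm_le_finite_approx)
    fix q and e :: real assume e: "e > 0"
    define g where "g p n = partial_limit (fst p @ [n]) (snd p)" for p n
    obtain n where n: "Suc (sum_list xs + sum_list ys) \<le> n"
      "\<And>p. p \<in> {xs, ys} \<times> {..<q} \<Longrightarrow> \<bar>g p n - \<Lambda> (g p)\<bar> < e/2"
      using generalized_limit_approx[OF \<Lambda>, of "{xs, ys} \<times> {..<q}" g R "e/2" "Suc (sum_list xs + sum_list ys)"]
        abs_partial_limit_le e unfolding g_def by auto
    have len: "length xs < k" "length ys < k"
      using Suc by auto
    have "{i. i < length (xs @ [n]) \<and> (xs @ [n]) ! i \<noteq> (ys @ [n]) ! i} = {i. i < length xs \<and> xs ! i \<noteq> ys ! i}"
      using Suc(3) by (auto simp: nth_append less_Suc_eq)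
    then have "norm_le (\<lambda>i. partial_limit (xs @ [n]) i - partial_limit (ys @ [n]) i) L"
      using Suc(2-) n(1) by (intro Suc(1) sorted_wrt_append_gt) auto
    moreover have "\<bar>partial_limit xs i - partial_limit ys i -
        (partial_limit (xs @ [n]) i - partial_limit (ys @ [n]) i)\<bar> < e" if "i < q" for i
    proof -
      have "\<bar>partial_limit (xs @ [n]) i - partial_limit xs i\<bar> < e/2"
        using n(2)[of "(xs, i)"] that partial_limit_step[OF len(1), of i] by (simp add: g_def[abs_def])
      moreover have "\<bar>partial_limit (ys @ [n]) i - partial_limit ys i\<bar> < e/2"
        using n(2)[of "(ys, i)"] that partial_limit_step[OF len(2), of i] by (simp add: g_def[abs_def])
      ultimately show ?thesis
        by linarith
    qed
    ultimately show "\<exists>w. norm_le w L \<and> (\<forall>i<q. \<bar>partial_limit xs i - partial_limit ys i - w i\<bar> < e)"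
      by (intro exI[of _ "\<lambda>i. partial_limit (xs @ [n]) i - partial_limit (ys @ [n]) i"]) auto
  qed
qed

lemma norm_le_partial_limit_step:
  assumes "length xs < k" "sorted_wrt (<) (xs @ [a])"
  shows "norm_le (\<lambda>i. partial_limit (xs @ [a]) i - partial_limit xs i) L"
proof (rule norm_le_finite_approx)
  fix q and e :: real assume e: "e > 0"
  obtain n where n: "Suc (sum_list xs) \<le> n"
    "\<And>i. i \<in> {..<q} \<Longrightarrow> \<bar>partial_limit (xs @ [n]) i - \<Lambda> (\<lambda>n. partial_limit (xs @ [n]) i)\<bar> < e"
    using generalized_limit_approx[OF \<Lambda>, of "{..<q}" "\<lambda>i n. partial_limit (xs @ [n]) i" R e "Suc (sum_list xs)"]
        abs_partial_limit_le e by auto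
  have "{i. i < length (xs @ [a]) \<and> (xs @ [a]) ! i \<noteq> (xs @ [n]) ! i} \<subseteq> {length xs}"
    by (auto simp: nth_append)
  then have "card {i. i < length (xs @ [a]) \<and> (xs @ [a]) ! i \<noteq> (xs @ [n]) ! i} \<le> card {length xs}"
    by (intro card_mono) auto
  moreover have "sorted_wrt (<) (xs @ [n])"
    using assms(2) n(1) by (intro sorted_wrt_append_gt) (auto simp: sorted_wrt_append)
  ultimately have "norm_le (\<lambda>i. partial_limit (xs @ [a]) i - partial_limit (xs @ [n]) i) L"
    using assms by (intro norm_le_partial_limit_diff) auto
  then show "\<exists>w. norm_le w L \<and> (\<forall>i<q. \<bar>partial_limit (xs @ [a]) i - partial_limit xs i - w i\<bar> < e)"
    using n(2) assms(1)
    by (intro exI[of _ "\<lambda>i. partial_limit (xs @ [a]) i - partial_limit (xs @ [n]) i"])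
      (auto simp: partial_limit_step)
qed

text \<open>
  Along a steady list the limit values hardly depend on the list.  Hence two steady lists of equal
  length have partial limits whose limits as sequences almost agree.
\<close>

definition steady :: "real \<Rightarrow> nat list \<Rightarrow> bool" where
  "steady e xs \<longleftrightarrow> sorted_wrt (<) xs \<and> length xs \<le> k \<and>
     (\<forall>j. length xs \<le> j \<longrightarrow> j \<le> k \<longrightarrow> \<bar>limit_value j xs - limit_value j []\<bar> \<le> real (length xs) * e)"

text \<open>
  The requirements on the new element are closeness of finitely many bounded sequences to their
  generalized limits, so one large element meets all of them.
\<close>

lemma steady_extend:
  assumes xs: "steady e xs" "length xs < k" and e: "e > 0" and A: "finite A"
  obtains a where "a \<notin> A" "steady e (xs @ [a])"
    "norm_le (\<lambda>i. partial_limit (xs @ [a]) i - partial_limit xs i) L"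
    "norm_le (window 0 q (\<lambda>i. partial_limit (xs @ [a]) i - partial_limit xs i)) e"
proof -
  define d where "d = e / (real q + 1)"
  have d: "d > 0" "d \<le> e" "real q * d \<le> e"
    using e by (auto simp: d_def field_simps)
  define g where "g p n = (case p of Inl i \<Rightarrow> partial_limit (xs @ [n]) i | Inr j \<Rightarrow> limit_value j (xs @ [n]))"
    for p n
  have g_le: "\<bar>g p n\<bar> \<le> R" for p n
    by (cases p) (simp_all add: g_def abs_partial_limit_le abs_limit_value_le)
  define I where "I = Inl ` {..<q} \<union> Inr ` {..k}"
  have "finite I"
    by (simp add: I_def)
  obtain a where a: "Suc (sum_list xs + \<Sum>A) \<le> a" "\<And>p. p \<in> I \<Longrightarrow> \<bar>g p a - \<Lambda> (g p)\<bar> < d"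
    by (rule generalized_limit_approx[where g = g and N = "Suc (sum_list xs + \<Sum>A)",
          OF \<Lambda> \<open>finite I\<close> g_le d(1)]) (rule that, assumption, blast)
  have "a \<notin> A"
  proof
    assume "a \<in> A"
    then have "a \<le> \<Sum>A"
      using A by (intro member_le_sum[where f = "\<lambda>x. x"]) auto
    with a(1) show False
      by simp
  qed
  have sorted: "sorted_wrt (<) (xs @ [a])"
    using xs(1) a(1) by (intro sorted_wrt_append_gt) (auto simp: steady_def)
  have coords: "\<bar>partial_limit (xs @ [a]) i - partial_limit xs i\<bar> < d" if "i < q" for i
    using a(2)[of "Inl i"] that partial_limit_step[OF xs(2), of i] by (simp add: I_def g_def[abs_def])
  have limit_values: "\<bar>limit_value j (xs @ [a]) - limit_value j xs\<bar> < d" if "length xs < j" "j \<le> k" for j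
    using a(2)[of "Inr j"] that limit_value_step[OF that(1)] by (simp add: I_def g_def[abs_def])
  have "\<bar>limit_value j (xs @ [a]) - limit_value j []\<bar> \<le> real (length (xs @ [a])) * e"
    if "length (xs @ [a]) \<le> j" "j \<le> k" for j
  proof -
    have "\<bar>limit_value j xs - limit_value j []\<bar> \<le> real (length xs) * e"
      using xs(1) that by (simp add: steady_def)
    then show ?thesis
      using limit_values[of j] that d(2) by (simp add: algebra_simps)
  qed
  then have "steady e (xs @ [a])"
    using sorted xs(2) by (simp add: steady_def)
  moreover have "norm_le (window 0 q (\<lambda>i. partial_limit (xs @ [a]) i - partial_limit xs i)) e"
    using coords by (intro norm_le_mono[OF norm_le_window_0_small d(3)]) (auto intro: less_imp_le)
  ultimately show ?thesis
    using \<open>a \<notin> A\<close> norm_le_partial_limit_step[OF xs(2) sorted] by (intro that)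
qed

definition pair_diff :: "nat list \<Rightarrow> nat list \<Rightarrow> nat \<Rightarrow> real" where
  "pair_diff xs ys = (\<lambda>i. partial_limit xs i - partial_limit ys i)"

lemma norm_le_pair_diff: "norm_le (pair_diff xs ys) (R + R)"
  unfolding pair_diff_def by (intro norm_le_diff norm_le_partial_limit)

lemma lim_pair_diff: "lim (pair_diff xs ys) = lim (partial_limit xs) - lim (partial_limit ys)"
  unfolding pair_diff_def
  by (intro limI tendsto_diff norm_le_imp_LIMSEQ_lim[OF norm_le_partial_limit])

lemma steady_balanced:
  assumes "steady e xs" "steady e ys" "length xs = length ys" "e \<ge> 0"
  shows "\<bar>lim (pair_diff xs ys)\<bar> \<le> real (2 * k) * e"
proof -
  define j where "j = length xs"
  have j: "j \<le> k"
    using assms(1) by (simp add: steady_def j_def)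
  have "\<bar>limit_value j xs - limit_value j []\<bar> \<le> real j * e"
    "\<bar>limit_value j ys - limit_value j []\<bar> \<le> real j * e"
    using assms j unfolding steady_def j_def by auto
  moreover have "limit_value j xs = lim (partial_limit xs)" "limit_value j ys = lim (partial_limit ys)"
    using limit_value_full[of xs] limit_value_full[of ys] assms(3) by (simp_all add: j_def)
  moreover have "real j * e \<le> real k * e"
    using j assms(4) by (intro mult_right_mono) auto
  moreover have "real (2 * k) * e = real k * e + real k * e"
    by (simp add: algebra_simps)
  ultimately show ?thesis
    unfolding lim_pair_diff by linarith
qed

lemma steady_Nil: "steady e []"
  by (simp add: steady_def)

text \<open>
  The state after \<open>i\<close> choices: \<open>xs\<close> and \<open>ys\<close> are extended in turn, and from \<open>q\<close> on the difference of their
  partial limits is close to a constant.  The bound \<open>L\<close> on that constant comes from the moments when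
  \<open>xs\<close> is one element ahead.
\<close>

definition interlaced :: "real \<Rightarrow> nat \<Rightarrow> nat list \<times> nat list \<times> nat \<Rightarrow> bool" where
  "interlaced e i = (\<lambda>(xs, ys, q). length xs = (i + 1) div 2 \<and> length ys = i div 2 \<and>
     steady e xs \<and> steady e ys \<and> set xs \<inter> set ys = {} \<and> 2 * k \<le> q \<and>
     \<bar>lim (pair_diff xs ys)\<bar> \<le> L + real (2 * k) * e \<and>
     norm_le (tail_from q (\<lambda>j. pair_diff xs ys j - lim (pair_diff xs ys))) e)"

definition small_step :: "real \<Rightarrow> nat list \<times> nat list \<times> nat \<Rightarrow> nat list \<times> nat list \<times> nat \<Rightarrow> bool" where
  "small_step e = (\<lambda>(xs, ys, q) (xs', ys', q'). q \<le> q' \<and>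
     norm_le (\<lambda>j. pair_diff xs' ys' j - pair_diff xs ys j) L \<and>
     norm_le (window 0 q (\<lambda>j. pair_diff xs' ys' j - pair_diff xs ys j)) e)"

lemma interlaced_extend:
  assumes s: "interlaced e i s" and i: "i < 2 * k" and e: "e > 0"
  shows "\<exists>s'. interlaced e (Suc i) s' \<and> small_step e s s'"
proof -
  obtain xs ys q where s_eq: "s = (xs, ys, q)"
    by (cases s)
  have state: "length xs = (i + 1) div 2" "length ys = i div 2" "steady e xs" "steady e ys"
    "set xs \<inter> set ys = {}" "2 * k \<le> q"
    using s by (simp_all add: s_eq interlaced_def)
  have finish: ?thesis
    if len: "length xs' = (Suc i + 1) div 2" "length ys' = Suc i div 2"
      and steady: "steady e xs'" "steady e ys'" and disj: "set xs' \<inter> set ys' = {}"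
      and le: "\<bar>lim (pair_diff xs' ys')\<bar> \<le> L + real (2 * k) * e"
      and step: "norm_le (\<lambda>j. pair_diff xs' ys' j - pair_diff xs ys j) L"
        "norm_le (window 0 q (\<lambda>j. pair_diff xs' ys' j - pair_diff xs ys j)) e" for xs' ys'
  proof -
    obtain q' where q': "q \<le> q'"
      "norm_le (tail_from q' (\<lambda>j. pair_diff xs' ys' j - lim (pair_diff xs' ys'))) e"
      using norm_le_tail_minus_lim[OF norm_le_pair_diff e] by blast
    then have "interlaced e (Suc i) (xs', ys', q')"
      using len steady disj le state(6) by (simp add: interlaced_def)
    moreover have "small_step e s (xs', ys', q')"
      using step q'(1) by (simp add: s_eq small_step_def)
    ultimately show ?thesis
      by blast
  qed
  show ?thesis
  proof (cases "even i")
    case True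
    then have len: "length xs = length ys" "length xs < k"
      using state i by (auto elim!: evenE)
    obtain a where a: "a \<notin> set ys" "steady e (xs @ [a])"
      "norm_le (\<lambda>i. partial_limit (xs @ [a]) i - partial_limit xs i) L"
      "norm_le (window 0 q (\<lambda>i. partial_limit (xs @ [a]) i - partial_limit xs i)) e"
      using steady_extend[OF state(3) len(2) e, of "set ys" q] by auto
    have eq: "(\<lambda>j. pair_diff (xs @ [a]) ys j - pair_diff xs ys j) =
        (\<lambda>j. partial_limit (xs @ [a]) j - partial_limit xs j)"
      by (simp add: pair_diff_def)
    have "\<bar>lim (pair_diff (xs @ [a]) xs)\<bar> \<le> L"
      using a(3) by (intro abs_lim_le_if_norm_le) (simp add: pair_diff_def)
    moreover have "\<bar>lim (pair_diff xs ys)\<bar> \<le> real (2 * k) * e"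
      using state len e by (intro steady_balanced) auto
    ultimately have "\<bar>lim (pair_diff (xs @ [a]) ys)\<bar> \<le> L + real (2 * k) * e"
      unfolding lim_pair_diff by linarith
    then show ?thesis
      using True state a by (intro finish[of "xs @ [a]" ys]) (simp_all add: eq)
  next
    case False
    then have len: "length xs = Suc (length ys)" "length ys < k"
      using state i by (auto elim!: oddE)
    obtain a where a: "a \<notin> set xs" "steady e (ys @ [a])"
      "norm_le (\<lambda>i. partial_limit (ys @ [a]) i - partial_limit ys i) L"
      "norm_le (window 0 q (\<lambda>i. partial_limit (ys @ [a]) i - partial_limit ys i)) e"
      using steady_extend[OF state(4) len(2) e, of "set xs" q] by auto
    have eq: "(\<lambda>j. pair_diff xs (ys @ [a]) j - pair_diff xs ys j) =
        (\<lambda>j. - (partial_limit (ys @ [a]) j - partial_limit ys j))"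
      by (simp add: pair_diff_def)
    have eq': "window 0 q (\<lambda>j. - (partial_limit (ys @ [a]) j - partial_limit ys j)) =
        (\<lambda>j. - window 0 q (\<lambda>j. partial_limit (ys @ [a]) j - partial_limit ys j) j)"
      by (auto simp: window_def)
    have "\<bar>lim (pair_diff xs (ys @ [a]))\<bar> \<le> real (2 * k) * e"
      using state a len e by (intro steady_balanced) auto
    then have le: "\<bar>lim (pair_diff xs (ys @ [a]))\<bar> \<le> L + real (2 * k) * e"
      using L_nonneg by linarith
    show ?thesis
    proof (rule finish)
      show "length xs = (Suc i + 1) div 2" "length (ys @ [a]) = Suc i div 2"
        using False state by (auto elim!: oddE)
      show "set xs \<inter> set (ys @ [a]) = {}"
        using state(5) a(1) by simp
      show "norm_le (\<lambda>j. pair_diff xs (ys @ [a]) j - pair_diff xs ys j) L"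
        unfolding eq using a(3) by (rule norm_le_minus)
      show "norm_le (window 0 q (\<lambda>j. pair_diff xs (ys @ [a]) j - pair_diff xs ys j)) e"
        unfolding eq eq' using a(4) by (rule norm_le_minus)
    qed (fact state(3) a(2) le)+
  qed
qed

text \<open>
  The tolerance \<open>e\<close> is chosen such that all errors in \<open>norm_le_chain\<close>, with \<open>r = 2 * k\<close> and
  \<open>K = L + 2 * k * e\<close>, add up to 1.
\<close>

lemma far_points_with_close_images:
  assumes k: "0 < k"
  obtains m n where "finite m" "card m = k" "finite n" "card n = k" "hamming_dist k m n = k"
    "norm_le (\<lambda>i. f m i - f n i) (4 * L + 1)"
proof -
  define e where "e = 1 / (10 * real k + 3)"
  have e: "e > 0"
    by (simp add: e_def add_nonneg_pos)
  have lim_0: "lim (pair_diff [] []) = 0"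
    by (simp add: lim_pair_diff)
  have "tail_from (2 * k) (\<lambda>j. pair_diff [] [] j - lim (pair_diff [] [])) = (\<lambda>j. 0)"
    unfolding lim_0 by (auto simp: tail_from_def pair_diff_def)
  then have "norm_le (tail_from (2 * k) (\<lambda>j. pair_diff [] [] j - lim (pair_diff [] []))) e"
    using e norm_le_mono[OF norm_le_const[of 0], of e] by simp
  then have base: "interlaced e 0 ([], [], 2 * k)"
    using e L_nonneg by (simp add: interlaced_def steady_Nil lim_0)
  have "\<exists>S. \<forall>i. (i \<le> 2 * k \<longrightarrow> interlaced e i (S i)) \<and> (i < 2 * k \<longrightarrow> small_step e (S i) (S (Suc i)))"
  proof (rule dependent_nat_choice)
    show "\<exists>s. 0 \<le> 2 * k \<longrightarrow> interlaced e 0 s"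
      using base by blast
    fix s i assume s: "i \<le> 2 * k \<longrightarrow> interlaced e i s"
    show "\<exists>s'. (Suc i \<le> 2 * k \<longrightarrow> interlaced e (Suc i) s') \<and> (i < 2 * k \<longrightarrow> small_step e s s')"
    proof (cases "i < 2 * k")
      case True
      then have "\<exists>s'. interlaced e (Suc i) s' \<and> small_step e s s'"
        using s by (intro interlaced_extend[OF _ True e]) auto
      then show ?thesis
        by blast
    next
      case False
      then show ?thesis
        by simp
    qed
  qed
  then obtain S where S: "\<And>i. i \<le> 2 * k \<Longrightarrow> interlaced e i (S i)"
    "\<And>i. i < 2 * k \<Longrightarrow> small_step e (S i) (S (Suc i))"
    by blast
  define X Y Q where "X i = fst (S i)" and "Y i = fst (snd (S i))" and "Q i = snd (snd (S i))" for i
  have S_eq: "S i = (X i, Y i, Q i)" for i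
    by (simp add: X_def Y_def Q_def)
  have state: "length (X i) = (i + 1) div 2" "length (Y i) = i div 2" "steady e (X i)" "steady e (Y i)"
    "set (X i) \<inter> set (Y i) = {}" "2 * k \<le> Q i"
    "\<bar>lim (pair_diff (X i) (Y i))\<bar> \<le> L + real (2 * k) * e"
    "norm_le (tail_from (Q i) (\<lambda>j. pair_diff (X i) (Y i) j - lim (pair_diff (X i) (Y i)))) e"
    if "i \<le> 2 * k" for i
    using S(1)[OF that] unfolding S_eq interlaced_def by auto
  have step: "Q i \<le> Q (Suc i)"
    "norm_le (\<lambda>j. pair_diff (X (Suc i)) (Y (Suc i)) j - pair_diff (X i) (Y i) j) L"
    "norm_le (window 0 (Q i) (\<lambda>j. pair_diff (X (Suc i)) (Y (Suc i)) j - pair_diff (X i) (Y i) j)) e"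
    if "i < 2 * k" for i
    using S(2)[OF that] unfolding S_eq small_step_def by auto
  define xs ys where "xs = X (2 * k)" and "ys = Y (2 * k)"
  have xs: "length xs = k" "sorted_wrt (<) xs" and ys: "length ys = k" "sorted_wrt (<) ys"
    and disj: "set xs \<inter> set ys = {}"
    using state(1-5)[of "2 * k"] by (auto simp: xs_def ys_def steady_def)
  have card: "card (set xs) = k" "card (set ys) = k"
    using xs ys by (simp_all add: strict_sorted_iff distinct_card)
  have limits: "partial_limit xs = f (set xs)" "partial_limit ys = f (set ys)"
    using xs ys by (simp_all add: partial_limit_full on_list_def)
  have "f (set xs) \<longlonglongrightarrow> 0" "f (set ys) \<longlonglongrightarrow> 0"
    using f_mem card by (simp_all add: tree_space_def)
  then have "lim (pair_diff xs ys) = 0"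
    unfolding lim_pair_diff limits by (simp add: limI)
  then have "norm_le (pair_diff (X (2 * k)) (Y (2 * k))) (real (2 * k) * e +
      2 * (real (2 * k) * e + L + e + (L + real (2 * k) * e)) + e)"
    using k step state(6)[of 0]
    by (intro norm_le_chain[where w = "\<lambda>i. pair_diff (X i) (Y i)" and q = Q
          and c = "\<lambda>i. lim (pair_diff (X i) (Y i))"] state(7,8))
      (auto simp: xs_def ys_def pair_diff_def state(1,2)[of 0, simplified])
  moreover have "real (2 * k) * e + 2 * (real (2 * k) * e + L + e + (L + real (2 * k) * e)) + e =
      4 * L + (10 * real k + 3) * e"
    by (simp add: algebra_simps)
  moreover have "(10 * real k + 3) * e = 1"
    by (simp add: e_def)
  ultimately have "norm_le (pair_diff xs ys) (4 * L + 1)"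
    unfolding xs_def ys_def by (simp only:)
  then have "norm_le (\<lambda>i. f (set xs) i - f (set ys) i) (4 * L + 1)"
    by (simp add: pair_diff_def limits)
  moreover have "hamming_dist k (set xs) (set ys) = k"
  proof -
    have "sorted_list_of_set (set xs) = xs" "sorted_list_of_set (set ys) = ys"
      using xs ys by (simp_all add: strict_sorted_iff sorted_list_of_set.idem_if_sorted_distinct)
    moreover have "xs ! i \<noteq> ys ! i" if "i < k" for i
      using that disj xs(1) ys(1) by (metis disjoint_iff nth_mem)
    ultimately have "{i. i < k \<and> sorted_list_of_set (set xs) ! i \<noteq> sorted_list_of_set (set ys) ! i} = {..<k}"
      by auto
    then show ?thesis
      by (simp add: hamming_dist_def)
  qed
  ultimately show ?thesis
    using card by (intro that[of "set xs" "set ys"]) auto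
qed

end

section \<open>A non-reflexive space without the Hamming graphs\<close>

theorem corollary5p2:
  shows "\<exists>(V :: (nat \<Rightarrow> real) set) (N :: (nat \<Rightarrow> real) \<Rightarrow> real).
           banach_on V N \<and> \<not> reflexive_on V N \<and>
           \<not> equi_coarsely_embeds {1..} hamming_metric (norm_metric V N)"
proof (intro exI conjI notI)
  show "banach_on tree_space tree_norm"
    by (rule banach_on_tree_space)
  show False if "reflexive_on tree_space tree_norm"
    using not_reflexive_on_tree_space that by blast
  assume "equi_coarsely_embeds {1..} hamming_metric (norm_metric tree_space tree_norm)"
  then obtain \<rho> \<omega> :: "real \<Rightarrow> real" and f where \<omega>: "\<forall>t\<ge>0. 0 \<le> \<omega> t"
    and \<rho>: "filterlim \<rho> at_top at_top"
    and embed: "\<forall>k\<in>{1..}. f k \<in> mspace (hamming_metric k) \<rightarrow> mspace (norm_metric tree_space tree_norm) \<and>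
      (\<forall>t\<ge>0. ennreal (\<rho> t) \<le> compression_modulus (hamming_metric k) (norm_metric tree_space tree_norm) (f k) t \<and>
         expansion_modulus (hamming_metric k) (norm_metric tree_space tree_norm) (f k) t \<le> ennreal (\<omega> t))"
    unfolding equi_coarsely_embeds_def by blast
  have f: "\<And>k. k \<ge> 1 \<Longrightarrow> f k \<in> mspace (hamming_metric k) \<rightarrow> mspace (norm_metric tree_space tree_norm)"
      "\<And>k t. k \<ge> 1 \<Longrightarrow> t \<ge> 0 \<Longrightarrow>
         ennreal (\<rho> t) \<le> compression_modulus (hamming_metric k) (norm_metric tree_space tree_norm) (f k) t"
      "\<And>k t. k \<ge> 1 \<Longrightarrow> t \<ge> 0 \<Longrightarrow>
         expansion_modulus (hamming_metric k) (norm_metric tree_space tree_norm) (f k) t \<le> ennreal (\<omega> t)"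
    using embed by auto
  define L where "L = \<omega> 1"
  have "\<forall>\<^sub>F t in at_top. \<rho> t > 4 * L + 1"
    using \<rho> unfolding filterlim_at_top_dense by blast
  then obtain t0 where t0: "\<And>t. t \<ge> t0 \<Longrightarrow> \<rho> t > 4 * L + 1"
    unfolding eventually_at_top_linorder by blast
  obtain k0 :: nat where "real k0 \<ge> t0"
    using real_arch_simple by blast
  define k where "k = Suc k0"
  have k: "k \<ge> 1" "\<rho> (real k) > 4 * L + 1"
    using t0[of "real k"] \<open>real k0 \<ge> t0\<close> by (auto simp: k_def)
  have mem: "f k m \<in> tree_space" if "finite m" "card m = k" for m
    using f(1)[OF k(1)] that by (auto simp: mspace_hamming_metric)
  have upper: "tree_norm (f k m - f k n) \<le> \<omega> t"
    if "finite m" "card m = k" "finite n" "card n = k" "real (hamming_dist k m n) \<le> t" "t \<ge> 0" for m n t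
  proof -
    have "ennreal (mdist (norm_metric tree_space tree_norm) (f k m) (f k n)) \<le>
        expansion_modulus (hamming_metric k) (norm_metric tree_space tree_norm) (f k) t"
      unfolding expansion_modulus_def using that
      by (intro Sup_upper) (auto simp: mspace_hamming_metric mdist_hamming_metric)
    also have "\<dots> \<le> ennreal (\<omega> t)"
      using f(3)[OF k(1)] that by blast
    finally show ?thesis
      using \<omega> that by (simp add: mdist_tree_space mem)
  qed
  have lower: "\<rho> t \<le> tree_norm (f k m - f k n)"
    if "finite m" "card m = k" "finite n" "card n = k" "t \<le> real (hamming_dist k m n)" "t \<ge> 0" for m n t
  proof -
    have "ennreal (\<rho> t) \<le> compression_modulus (hamming_metric k) (norm_metric tree_space tree_norm) (f k) t"
      using f(2)[OF k(1)] that by blast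
    also have "\<dots> \<le> ennreal (mdist (norm_metric tree_space tree_norm) (f k m) (f k n))"
      unfolding compression_modulus_def using that
      by (intro Inf_lower) (auto simp: mspace_hamming_metric mdist_hamming_metric)
    finally show ?thesis
      using that norm_le_nonneg[OF norm_le_tree_norm_if_mem[OF subspace_diff[OF subspace_tree_space mem mem]]]
      by (simp add: mdist_tree_space mem ennreal_le_iff)
  qed
  obtain \<Lambda> where \<Lambda>: "generalized_limit \<Lambda>"
    using generalized_limit_exists by blast
  define R where "R = tree_norm (f k {..<k}) + \<omega> (real k)"
  interpret hamming_lipschitz \<Lambda> k "f k" R L
  proof
    fix m :: "nat set" assume m: "finite m" "card m = k"
    have "hamming_dist k m {..<k} \<le> card {..<k}"
      unfolding hamming_dist_def by (intro card_mono) auto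
    then have "norm_le (\<lambda>i. f k m i - f k {..<k} i) (\<omega> (real k))"
      using m by (intro norm_le_if_tree_norm_diff_le mem upper) auto
    then have "norm_le (\<lambda>i. f k {..<k} i + (f k m i - f k {..<k} i)) R"
      unfolding R_def by (intro norm_le_add norm_le_tree_norm_if_mem mem) auto
    then show "norm_le (f k m) R"
      by simp
  next
    fix m n assume "finite m" "card m = k" "finite n" "card n = k" "hamming_dist k m n \<le> 1"
    then show "norm_le (\<lambda>i. f k m i - f k n i) L"
      unfolding L_def by (intro norm_le_if_tree_norm_diff_le mem upper) auto
  qed (use \<Lambda> mem in auto)
  obtain m n where mn: "finite m" "card m = k" "finite n" "card n = k" "hamming_dist k m n = k"
    "norm_le (\<lambda>i. f k m i - f k n i) (4 * L + 1)"
    using far_points_with_close_images k(1) by auto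
  have "\<rho> (real k) \<le> tree_norm (f k m - f k n)"
    using mn by (intro lower) auto
  also have "\<dots> \<le> 4 * L + 1"
    unfolding fun_diff_def using mn(6) by (rule tree_norm_le)
  finally show False
    using k(2) by simp
qed

end
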